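(* Let $\mathcal T=(V,\mathcal E)$ be a countably infinite, leafless, rootless directed tree and let $\boldsymbol\lambda=\{\lambda_v\}_{v\in V}$ be positive weights such that the weighted shift $S_{\boldsymbol\lambda}$ is a bounded, left-invertible, non-analytic operator on $\ell^2(V)$. Then $S_{\boldsymbol\lambda}^\infty(\ell^2(V))$ reduces $S_{\boldsymbol\lambda}$ if and only if $S_{\boldsymbol\lambda}$ is balanced. Moreover, if $S_{\boldsymbol\lambda}$ is balanced, then $$\ell^2(V)=S_{\boldsymbol\lambda}^\infty(\ell^2(V))\oplus\ker S_{\boldsymbol\lambda}^*\oplus S_{\boldsymbol\lambda}(\ker S_{\boldsymbol\lambda}^* )\oplus S_{\boldsymbol\lambda}^2(\ker S_{\boldsymbol\lambda}^* )\oplus\cdots$$ (orthogonal Hilbert space direct sum).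
   Context: $\mathbb N$ denotes the non-negative integers. A directed tree $\mathcal T=(V,\mathcal E)$ is a directed graph (no self-loops) that is connected as an undirected graph, has no directed circuits, and in which each vertex $v$ has at most one parent, i.e. vertex $u$ with $(u,v)\in\mathcal E$. It is rootless if every $v$ has a parent, denoted $\mathsf{par}(v)$; $\mathsf{par}^{\langle n\rangle}$ is the $n$-fold composition of $\mathsf{par}$. It is leafless if every vertex is the parent of some vertex. Vertices $u,v$ belong to the same generation if $\mathsf{par}^{\langle n\rangle}(u)=\mathsf{par}^{\langle n\rangle}(v)$ for some $n\in\mathbb N$. $\ell^2(V)$ is the Hilbert space of square summable complex functions on $V$, with orthonormal basis $e_u$ = indicator function of $\{u\}$. The weighted shift is $(S_{\boldsymbol\lambda}f)(v)=\lambda_v f(\mathsf{par}(v))$, $v\in V$. It is balanced if $\|S_{\boldsymbol\lambda}e_u\|=\|S_{\boldsymbol\lambda}e_v\|$ for all $u,v$ in the same generation. For a bounded operator $T$ on $\mathcal H$, $T^\infty(\mathcal H)=\bigcap_{n\geq0}T^n\mathcal H$, and $T$ is analytic if $T^\infty(\mathcal H)=\{0\}$. *)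

theory Defs
  imports "HOL-Analysis.Analysis"
begin

text \<open>A directed graph is given by its vertex set \<open>V\<close> and its edge relation \<open>E\<close>; \<open>(u, v) \<in> E\<close> means
  that \<open>u\<close> is a parent of \<open>v\<close>.\<close>

definition directed_tree :: "'v set \<Rightarrow> ('v \<times> 'v) set \<Rightarrow> bool" where
  "directed_tree V E \<longleftrightarrow>
     V \<noteq> {} \<and> E \<subseteq> V \<times> V \<and>
     (\<forall>v. (v, v) \<notin> E) \<and>
     (\<forall>u\<in>V. \<forall>v\<in>V. (u, v) \<in> (E \<union> E\<inverse>)\<^sup>*) \<and>
     acyclic E \<and>
     (\<forall>u u' v. (u, v) \<in> E \<longrightarrow> (u', v) \<in> E \<longrightarrow> u = u')"

definition rootless :: "'v set \<Rightarrow> ('v \<times> 'v) set \<Rightarrow> bool" where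
  "rootless V E \<longleftrightarrow> (\<forall>v\<in>V. \<exists>u. (u, v) \<in> E)"

definition leafless :: "'v set \<Rightarrow> ('v \<times> 'v) set \<Rightarrow> bool" where
  "leafless V E \<longleftrightarrow> (\<forall>u\<in>V. \<exists>v. (u, v) \<in> E)"

text \<open>Unspecified at roots; only used for rootless trees.\<close>

definition par :: "('v \<times> 'v) set \<Rightarrow> 'v \<Rightarrow> 'v" where
  "par E v = (THE u. (u, v) \<in> E)"

definition same_generation :: "('v \<times> 'v) set \<Rightarrow> 'v \<Rightarrow> 'v \<Rightarrow> bool" where
  "same_generation E u v \<longleftrightarrow> (\<exists>n. (par E ^^ n) u = (par E ^^ n) v)"


text \<open>The Hilbert space \<open>\<ell>\<^sup>2(V)\<close> is a carrier set: complex functions on the ambient type that vanish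
  off \<open>V\<close> and are square summable on \<open>V\<close>. Vanishing off \<open>V\<close> makes equality of elements coincide with
  equality of functions on \<open>V\<close>.\<close>

definition ell2 :: "'v set \<Rightarrow> ('v \<Rightarrow> complex) set" where
  "ell2 V = {f. (\<forall>v. v \<notin> V \<longrightarrow> f v = 0) \<and> (\<lambda>v. (cmod (f v))\<^sup>2) summable_on V}"

definition ell2_inner :: "'v set \<Rightarrow> ('v \<Rightarrow> complex) \<Rightarrow> ('v \<Rightarrow> complex) \<Rightarrow> complex" where
  "ell2_inner V f g = (\<Sum>\<^sub>\<infinity>v\<in>V. f v * cnj (g v))"

definition ell2_norm :: "'v set \<Rightarrow> ('v \<Rightarrow> complex) \<Rightarrow> real" where
  "ell2_norm V f = sqrt (\<Sum>\<^sub>\<infinity>v\<in>V. (cmod (f v))\<^sup>2)"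

definition basis_vec :: "'v \<Rightarrow> 'v \<Rightarrow> complex" where
  "basis_vec u = indicator {u}"

text \<open>Only meaningful for \<open>s n, f \<in> ell2 V\<close>: \<open>ell2_norm\<close> is \<open>0\<close> on functions that are not square
  summable. All uses below respect this.\<close>

definition ell2_converges :: "'v set \<Rightarrow> (nat \<Rightarrow> 'v \<Rightarrow> complex) \<Rightarrow> ('v \<Rightarrow> complex) \<Rightarrow> bool" where
  "ell2_converges V s f \<longleftrightarrow> (\<lambda>n. ell2_norm V (\<lambda>v. s n v - f v)) \<longlonglongrightarrow> 0"

definition closed_subspace :: "'v set \<Rightarrow> ('v \<Rightarrow> complex) set \<Rightarrow> bool" where
  "closed_subspace V M \<longleftrightarrow>
     M \<subseteq> ell2 V \<and> (\<lambda>_. 0) \<in> M \<and>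
     (\<forall>f\<in>M. \<forall>g\<in>M. (\<lambda>v. f v + g v) \<in> M) \<and>
     (\<forall>c. \<forall>f\<in>M. (\<lambda>v. c * f v) \<in> M) \<and>
     (\<forall>s f. (\<forall>n. s n \<in> M) \<longrightarrow> f \<in> ell2 V \<longrightarrow> ell2_converges V s f \<longrightarrow> f \<in> M)"

definition orth_compl :: "'v set \<Rightarrow> ('v \<Rightarrow> complex) set \<Rightarrow> ('v \<Rightarrow> complex) set" where
  "orth_compl V M = {g \<in> ell2 V. \<forall>f\<in>M. ell2_inner V f g = 0}"

text \<open>\<open>ell2 V\<close> is the orthogonal Hilbert space direct sum of the \<open>M n\<close>: uniqueness of the components
  \<open>g n\<close> follows from orthogonality.\<close>

definition hilbert_direct_sum :: "'v set \<Rightarrow> (nat \<Rightarrow> ('v \<Rightarrow> complex) set) \<Rightarrow> bool" where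
  "hilbert_direct_sum V M \<longleftrightarrow>
     (\<forall>n. closed_subspace V (M n)) \<and>
     (\<forall>m n. m \<noteq> n \<longrightarrow> (\<forall>f\<in>M m. \<forall>g\<in>M n. ell2_inner V f g = 0)) \<and>
     (\<forall>f\<in>ell2 V. \<exists>g. (\<forall>n. g n \<in> M n) \<and> ell2_converges V (\<lambda>n v. \<Sum>k<n. g k v) f)"


text \<open>Operators are maps on all functions; only their values on \<open>ell2 V\<close> matter.\<close>

definition bounded_operator :: "'v set \<Rightarrow> (('v \<Rightarrow> complex) \<Rightarrow> 'v \<Rightarrow> complex) \<Rightarrow> bool" where
  "bounded_operator V T \<longleftrightarrow>
     (\<forall>f\<in>ell2 V. T f \<in> ell2 V) \<and>
     (\<forall>f\<in>ell2 V. \<forall>g\<in>ell2 V. T (\<lambda>v. f v + g v) = (\<lambda>v. T f v + T g v)) \<and>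
     (\<forall>c. \<forall>f\<in>ell2 V. T (\<lambda>v. c * f v) = (\<lambda>v. c * T f v)) \<and>
     (\<exists>C. \<forall>f\<in>ell2 V. ell2_norm V (T f) \<le> C * ell2_norm V f)"

definition left_invertible :: "'v set \<Rightarrow> (('v \<Rightarrow> complex) \<Rightarrow> 'v \<Rightarrow> complex) \<Rightarrow> bool" where
  "left_invertible V T \<longleftrightarrow> (\<exists>L. bounded_operator V L \<and> (\<forall>f\<in>ell2 V. L (T f) = f))"

definition adj :: "'v set \<Rightarrow> (('v \<Rightarrow> complex) \<Rightarrow> 'v \<Rightarrow> complex) \<Rightarrow> ('v \<Rightarrow> complex) \<Rightarrow> 'v \<Rightarrow> complex" where
  "adj V T g = (THE h. h \<in> ell2 V \<and> (\<forall>f\<in>ell2 V. ell2_inner V (T f) g = ell2_inner V f h))"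

definition ker :: "'v set \<Rightarrow> (('v \<Rightarrow> complex) \<Rightarrow> 'v \<Rightarrow> complex) \<Rightarrow> ('v \<Rightarrow> complex) set" where
  "ker V T = {f \<in> ell2 V. T f = (\<lambda>_. 0)}"

definition hyperrange :: "'v set \<Rightarrow> (('v \<Rightarrow> complex) \<Rightarrow> 'v \<Rightarrow> complex) \<Rightarrow> ('v \<Rightarrow> complex) set" where
  "hyperrange V T = (\<Inter>n. (T ^^ n) ` ell2 V)"

definition analytic_operator :: "'v set \<Rightarrow> (('v \<Rightarrow> complex) \<Rightarrow> 'v \<Rightarrow> complex) \<Rightarrow> bool" where
  "analytic_operator V T \<longleftrightarrow> hyperrange V T = {\<lambda>_. 0}"

definition reduces :: "'v set \<Rightarrow> ('v \<Rightarrow> complex) set \<Rightarrow> (('v \<Rightarrow> complex) \<Rightarrow> 'v \<Rightarrow> complex) \<Rightarrow> bool" where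
  "reduces V M T \<longleftrightarrow>
     closed_subspace V M \<and> T ` M \<subseteq> M \<and> T ` orth_compl V M \<subseteq> orth_compl V M"


definition weighted_shift ::
  "'v set \<Rightarrow> ('v \<times> 'v) set \<Rightarrow> ('v \<Rightarrow> real) \<Rightarrow> ('v \<Rightarrow> complex) \<Rightarrow> 'v \<Rightarrow> complex" where
  "weighted_shift V E w f v = (if v \<in> V then complex_of_real (w v) * f (par E v) else 0)"

definition balanced :: "'v set \<Rightarrow> ('v \<times> 'v) set \<Rightarrow> ('v \<Rightarrow> real) \<Rightarrow> bool" where
  "balanced V E w \<longleftrightarrow>
     (\<forall>u\<in>V. \<forall>v\<in>V. same_generation E u v \<longrightarrow>
        ell2_norm V (weighted_shift V E w (basis_vec u)) =
        ell2_norm V (weighted_shift V E w (basis_vec v)))"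

end

theory Submission
  imports Defs
begin

text \<open>Write \<open>S\<close> for the shift, \<open>M\<close> for its hyperrange, \<open>K\<close> for \<open>ker S\<^sup>*\<close>, and
  \<open>d(u) = \<parallel>S e\<^sub>u\<parallel>\<^sup>2\<close>. The images \<open>S e\<^sub>u\<close> have disjoint supports (the sets of children), so
  \<open>S\<^sup>* S\<close> is multiplication by \<open>d\<close> (lemma \<open>adj_shift_shift\<close>), and \<open>S\<close> is balanced exactly when
  this multiplier is constant on every generation. Everything rests on how \<open>d\<close> acts on \<open>M\<close>.

  Elements of \<open>M\<close> are rigid: \<open>f \<in> M\<close> lies in the range of every \<open>S\<^sup>n\<close>, hence its values at two
  vertices with a common \<open>n\<close>-th ancestor are determined by the value of one function at that ancestor.
  So any two elements of \<open>M\<close> are proportional on each generation (\<open>hyperrange_proportional\<close>). A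
  nonzero element of \<open>M\<close> can be moved up the tree by inverting \<open>S\<close> and down by applying it, and the
  tree is connected, so for every vertex some element of \<open>M\<close> is nonzero there
  (\<open>hyperrange_nonvanishing\<close>).

  Suppose \<open>M\<close> reduces \<open>S\<close>, let \<open>u, v\<close> be in the same generation, and let \<open>f \<in> M\<close> be nonzero at
  both. By rigidity the vector \<open>g\<close> supported on \<open>{u, v}\<close> with \<open>g \<bottom> f\<close> is orthogonal to all of
  \<open>M\<close>, so \<open>0 = \<langle>S f, S g\<rangle> = \<langle>d f, g\<rangle>\<close>, which says \<open>d(u) = d(v)\<close>.

  Conversely, let \<open>S\<close> be balanced. The spaces \<open>M\<close> and \<open>S\<^sup>n(\<ell>\<^sup>2)\<close> are invariant under bounded
  multipliers that are constant on generations. For such a space \<open>X\<close>, \<open>X \<bottom> Y\<close> implies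
  \<open>S X \<bottom> S Y\<close>, because \<open>\<langle>S x, S y\<rangle> = \<langle>d x, y\<rangle>\<close> and \<open>d x \<in> X\<close>
  (\<open>shift_preserves_orthogonality\<close>). Applied to \<open>M\<close> and its complement this gives that \<open>M\<close> reduces
  \<open>S\<close>; applied to \<open>S(\<ell>\<^sup>2) \<bottom> K\<close> repeatedly, it gives \<open>S\<^sup>n K \<bottom> S\<^sup>n\<^sup>+\<^sup>1(\<ell>\<^sup>2)\<close>, hence the mutual
  orthogonality in the decomposition. Completeness is Wold's argument: splitting off the \<open>K\<close>
  component again and again writes \<open>f\<close> as an orthogonal sum of elements of \<open>S\<^sup>j K\<close>, \<open>j < n\<close>,
  plus a remainder in \<open>S\<^sup>n(\<ell>\<^sup>2)\<close>. The norms of the remainders decrease, so the remainders are Cauchy,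
  and their limit lies in \<open>M\<close> because the ranges are closed (\<open>wold_expansion\<close>).\<close>

section \<open>The space of square summable functions\<close>

lemma ell2_norm_nonneg [simp]: "0 \<le> ell2_norm V f"
  by (simp add: ell2_norm_def infsum_nonneg)

lemma ell2_off: "f \<in> ell2 V \<Longrightarrow> v \<notin> V \<Longrightarrow> f v = 0"
  by (simp add: ell2_def)

lemma L2_set_le_ell2_norm:
  assumes "f \<in> ell2 V" "finite F" "F \<subseteq> V"
  shows "L2_set (\<lambda>v. cmod (f v)) F \<le> ell2_norm V f"
  unfolding L2_set_def ell2_norm_def
  by (rule real_sqrt_le_mono, rule finite_sum_le_infsum) (use assms in \<open>auto simp: ell2_def\<close>)

text \<open>Membership in \<open>\<ell>\<^sup>2\<close> and norm bounds are usually proved together, by a uniform bound on finite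
  pieces: this transfers the finite dimensional inequalities for \<open>L2_set\<close> (triangle inequality,
  monotonicity) to \<open>\<ell>\<^sup>2\<close>.\<close>

lemma ell2_bounded_partial_sums:
  assumes off: "\<And>v. v \<notin> V \<Longrightarrow> f v = 0" and "0 \<le> B"
    and le: "\<And>F. finite F \<Longrightarrow> F \<subseteq> V \<Longrightarrow> L2_set (\<lambda>v. cmod (f v)) F \<le> B"
  shows "f \<in> ell2 V \<and> ell2_norm V f \<le> B"
proof -
  have fin: "(\<Sum>v\<in>F. (cmod (f v))\<^sup>2) \<le> B\<^sup>2" if "finite F" "F \<subseteq> V" for F
    using le[OF that] \<open>0 \<le> B\<close> by (simp add: L2_set_def sqrt_le_D)
  have sm: "(\<lambda>v. (cmod (f v))\<^sup>2) summable_on V"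
    by (rule nonneg_bdd_above_summable_on) (use fin in \<open>auto intro!: bdd_aboveI2[where M = "B\<^sup>2"]\<close>)
  have "(\<Sum>\<^sub>\<infinity>v\<in>V. (cmod (f v))\<^sup>2) \<le> B\<^sup>2"
    by (rule infsum_le_finite_sums[OF sm fin])
  then have "ell2_norm V f \<le> B"
    using \<open>0 \<le> B\<close> by (simp add: ell2_norm_def real_le_lsqrt)
  then show ?thesis using sm off by (simp add: ell2_def)
qed

lemma ell2_zero [simp]: "(\<lambda>_. 0) \<in> ell2 V"
  by (simp add: ell2_def)

lemma ell2_add:
  assumes "f \<in> ell2 V" "g \<in> ell2 V"
  shows "(\<lambda>v. f v + g v) \<in> ell2 V"
proof (rule ell2_bounded_partial_sums[THEN conjunct1])
  fix F assume F: "finite F" "F \<subseteq> V"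
  have "L2_set (\<lambda>v. cmod (f v + g v)) F \<le> L2_set (\<lambda>v. cmod (f v) + cmod (g v)) F"
    by (rule L2_set_mono) (auto simp: norm_triangle_ineq)
  also have "\<dots> \<le> L2_set (\<lambda>v. cmod (f v)) F + L2_set (\<lambda>v. cmod (g v)) F"
    by (rule L2_set_triangle_ineq)
  finally show "L2_set (\<lambda>v. cmod (f v + g v)) F \<le> ell2_norm V f + ell2_norm V g"
    using L2_set_le_ell2_norm[OF assms(1) F] L2_set_le_ell2_norm[OF assms(2) F] by linarith
qed (use assms in \<open>auto simp: ell2_off\<close>)

lemma ell2_mult_bounded:
  assumes "f \<in> ell2 V" "0 \<le> B" "\<And>v. v \<in> V \<Longrightarrow> cmod (c v) \<le> B"
  shows "(\<lambda>v. c v * f v) \<in> ell2 V \<and> ell2_norm V (\<lambda>v. c v * f v) \<le> B * ell2_norm V f"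
proof (rule ell2_bounded_partial_sums)
  fix F assume F: "finite F" "F \<subseteq> V"
  have "L2_set (\<lambda>v. cmod (c v * f v)) F \<le> L2_set (\<lambda>v. B * cmod (f v)) F"
    by (rule L2_set_mono) (use assms F in \<open>auto simp: norm_mult intro!: mult_right_mono\<close>)
  also have "\<dots> = B * L2_set (\<lambda>v. cmod (f v)) F"
    using \<open>0 \<le> B\<close> by (simp add: L2_set_right_distrib)
  also have "\<dots> \<le> B * ell2_norm V f"
    using L2_set_le_ell2_norm[OF assms(1) F] \<open>0 \<le> B\<close> by (rule mult_left_mono)
  finally show "L2_set (\<lambda>v. cmod (c v * f v)) F \<le> B * ell2_norm V f" .
qed (use assms in \<open>auto simp: ell2_off\<close>)

lemma ell2_scale: "f \<in> ell2 V \<Longrightarrow> (\<lambda>v. c * f v) \<in> ell2 V"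
  using ell2_mult_bounded[of f V "cmod c" "\<lambda>_. c"] by auto

lemma ell2_diff: "f \<in> ell2 V \<Longrightarrow> g \<in> ell2 V \<Longrightarrow> (\<lambda>v. f v - g v) \<in> ell2 V"
  using ell2_add[of f V "\<lambda>v. - 1 * g v"] ell2_scale[of g V "- 1"] by simp

lemma ell2_norm_diff_commute: "ell2_norm V (\<lambda>v. f v - g v) = ell2_norm V (\<lambda>v. g v - f v)"
  by (simp add: ell2_norm_def norm_minus_commute)

lemma cmod_le_ell2_norm:
  assumes "f \<in> ell2 V"
  shows "cmod (f v) \<le> ell2_norm V f"
proof (cases "v \<in> V")
  case True
  then show ?thesis using L2_set_le_ell2_norm[OF assms, of "{v}"] by simp
qed (simp add: ell2_off[OF assms])

lemma ell2_norm_eq_0: "f \<in> ell2 V \<Longrightarrow> ell2_norm V f = 0 \<Longrightarrow> f = (\<lambda>_. 0)"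
  using cmod_le_ell2_norm[of f V] by fastforce

lemma ell2_inner_abs_summable:
  assumes "f \<in> ell2 V" "g \<in> ell2 V"
  shows "((\<lambda>v. cmod (f v * cnj (g v))) summable_on V) \<and>
    (\<Sum>\<^sub>\<infinity>v\<in>V. cmod (f v * cnj (g v))) \<le> ell2_norm V f * ell2_norm V g"
proof -
  have fin: "(\<Sum>v\<in>F. cmod (f v * cnj (g v))) \<le> ell2_norm V f * ell2_norm V g"
    if F: "finite F" "F \<subseteq> V" for F
  proof -
    have "(\<Sum>v\<in>F. cmod (f v * cnj (g v))) \<le> L2_set (\<lambda>v. cmod (f v)) F * L2_set (\<lambda>v. cmod (g v)) F"
      using L2_set_mult_ineq[of "\<lambda>v. cmod (f v)" "\<lambda>v. cmod (g v)" F] by (simp add: norm_mult)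
    also have "\<dots> \<le> ell2_norm V f * ell2_norm V g"
      by (rule mult_mono) (auto intro!: L2_set_le_ell2_norm assms F)
    finally show ?thesis .
  qed
  have sm: "(\<lambda>v. cmod (f v * cnj (g v))) summable_on V"
    by (rule nonneg_bdd_above_summable_on) (use fin in \<open>auto intro!: bdd_aboveI2\<close>)
  show ?thesis using sm infsum_le_finite_sums[OF sm fin] by simp
qed

lemma ell2_inner_summable:
  "f \<in> ell2 V \<Longrightarrow> g \<in> ell2 V \<Longrightarrow> (\<lambda>v. f v * cnj (g v)) summable_on V"
  by (rule abs_summable_summable, rule conjunct1[OF ell2_inner_abs_summable])

lemma ell2_Cauchy_Schwarz:
  "f \<in> ell2 V \<Longrightarrow> g \<in> ell2 V \<Longrightarrow> cmod (ell2_inner V f g) \<le> ell2_norm V f * ell2_norm V g"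
  unfolding ell2_inner_def
  using ell2_inner_abs_summable[of f V g] norm_infsum_bound[of "\<lambda>v. f v * cnj (g v)" V] by linarith

lemma ell2_inner_cnj: "ell2_inner V g f = cnj (ell2_inner V f g)"
  by (simp add: ell2_inner_def mult.commute flip: infsum_cnj)

lemma ell2_inner_eq_0_sym: "ell2_inner V g f = 0 \<longleftrightarrow> ell2_inner V f g = 0"
  by (subst ell2_inner_cnj) simp

lemma ell2_inner_add:
  "f \<in> ell2 V \<Longrightarrow> g \<in> ell2 V \<Longrightarrow> h \<in> ell2 V \<Longrightarrow>
    ell2_inner V (\<lambda>v. f v + g v) h = ell2_inner V f h + ell2_inner V g h"
  by (simp add: ell2_inner_def ring_distribs infsum_add ell2_inner_summable)

lemma ell2_inner_scale: "ell2_inner V (\<lambda>v. c * f v) h = c * ell2_inner V f h"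
  by (simp add: ell2_inner_def mult.assoc infsum_cmult_right')

lemma ell2_inner_diff:
  "f \<in> ell2 V \<Longrightarrow> g \<in> ell2 V \<Longrightarrow> h \<in> ell2 V \<Longrightarrow>
    ell2_inner V (\<lambda>v. f v - g v) h = ell2_inner V f h - ell2_inner V g h"
  using ell2_inner_add[of f V "\<lambda>v. - 1 * g v" h] ell2_scale[of g V "- 1"]
    ell2_inner_scale[of V "- 1" g h] by simp

lemma ell2_inner_zero [simp]: "ell2_inner V (\<lambda>_. 0) h = 0" "ell2_inner V h (\<lambda>_. 0) = 0"
  by (simp_all add: ell2_inner_def)

lemma ell2_inner_self:
  assumes "f \<in> ell2 V"
  shows "ell2_inner V f f = complex_of_real ((ell2_norm V f)\<^sup>2)"
proof -
  have "(\<Sum>\<^sub>\<infinity>v\<in>V. complex_of_real ((cmod (f v))\<^sup>2))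
      = complex_of_real (\<Sum>\<^sub>\<infinity>v\<in>V. (cmod (f v))\<^sup>2)"
    by (rule infsumI, rule has_sum_of_real, rule has_sum_infsum) (use assms in \<open>simp add: ell2_def\<close>)
  then show ?thesis
    by (simp add: ell2_inner_def ell2_norm_def infsum_nonneg complex_norm_square del: of_real_power)
qed

lemma ell2_inner_self_eq_0: "f \<in> ell2 V \<Longrightarrow> ell2_inner V f f = 0 \<Longrightarrow> f = (\<lambda>_. 0)"
  using ell2_norm_eq_0 by (auto simp: ell2_inner_self)

lemma ell2_Pythagoras:
  assumes f: "f \<in> ell2 V" and g: "g \<in> ell2 V" and 0: "ell2_inner V f g = 0"
  shows "(ell2_norm V (\<lambda>v. f v + g v))\<^sup>2 = (ell2_norm V f)\<^sup>2 + (ell2_norm V g)\<^sup>2"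
proof -
  let ?h = "\<lambda>v. f v + g v"
  have h: "?h \<in> ell2 V" using ell2_add f g .
  have "ell2_inner V ?h ?h = ell2_inner V f ?h + ell2_inner V g ?h"
    by (rule ell2_inner_add[OF f g h])
  also have "ell2_inner V f ?h = ell2_inner V f f"
    using ell2_inner_cnj[of V f ?h] ell2_inner_cnj[of V f f] 0 ell2_inner_eq_0_sym[of V g f]
    by (simp add: ell2_inner_add f g)
  also have "ell2_inner V g ?h = ell2_inner V g g"
    using ell2_inner_cnj[of V g ?h] ell2_inner_cnj[of V g g] 0
    by (simp add: ell2_inner_add f g)
  finally show ?thesis
    unfolding ell2_inner_self[OF f] ell2_inner_self[OF g] ell2_inner_self[OF h] of_real_add[symmetric] of_real_eq_iff .
qed

lemma basis_vec_apply: "basis_vec u v = (if v = u then 1 else 0)"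
  by (simp add: basis_vec_def indicator_def)

lemma ell2_finite_support:
  assumes "finite F" "F \<subseteq> V"
  shows "(\<lambda>v. if v \<in> F then f v else 0) \<in> ell2 V"
    and "ell2_norm V (\<lambda>v. if v \<in> F then f v else 0) = L2_set (\<lambda>v. cmod (f v)) F"
proof -
  have eq: "((\<lambda>v. (cmod (if v \<in> F then f v else 0))\<^sup>2) has_sum s) V
      \<longleftrightarrow> ((\<lambda>v. (cmod (f v))\<^sup>2) has_sum s) F" for s
    by (rule has_sum_cong_neutral) (use assms in auto)
  have hs: "((\<lambda>v. (cmod (if v \<in> F then f v else 0))\<^sup>2) has_sum (\<Sum>v\<in>F. (cmod (f v))\<^sup>2)) V"
    unfolding eq using assms(1) by simp
  show "(\<lambda>v. if v \<in> F then f v else 0) \<in> ell2 V"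
    using hs assms by (auto simp: ell2_def summable_on_def)
  show "ell2_norm V (\<lambda>v. if v \<in> F then f v else 0) = L2_set (\<lambda>v. cmod (f v)) F"
    using infsumI[OF hs] by (simp add: ell2_norm_def L2_set_def)
qed

lemma basis_vec_ell2: "u \<in> V \<Longrightarrow> basis_vec u \<in> ell2 V"
  and ell2_norm_basis_vec: "u \<in> V \<Longrightarrow> ell2_norm V (basis_vec u) = 1"
proof -
  assume u: "u \<in> V"
  have *: "(\<lambda>v. if v \<in> {u} then 1 else 0) = basis_vec u" by (auto simp: basis_vec_apply)
  show "basis_vec u \<in> ell2 V" "ell2_norm V (basis_vec u) = 1"
    using ell2_finite_support[of "{u}" V "\<lambda>_. 1", unfolded *] u by auto
qed

lemma ell2_inner_basis_vec: "u \<in> V \<Longrightarrow> ell2_inner V f (basis_vec u) = f u"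
proof -
  assume u: "u \<in> V"
  have "(\<Sum>\<^sub>\<infinity>v\<in>V. f v * cnj (basis_vec u v)) = (\<Sum>\<^sub>\<infinity>v\<in>{u}. f v)"
    by (rule infsum_cong_neutral) (use u in \<open>auto simp: basis_vec_apply\<close>)
  then show ?thesis by (simp add: ell2_inner_def)
qed

section \<open>Limits and closed subspaces\<close>

lemma ell2_converges_pointwise:
  assumes "ell2_converges V s f" "\<And>n. s n \<in> ell2 V" "f \<in> ell2 V"
  shows "(\<lambda>n. s n v) \<longlonglongrightarrow> f v"
proof -
  have "(\<lambda>n. s n v - f v) \<longlonglongrightarrow> 0"
    by (rule Lim_null_comparison[OF always_eventually assms(1)[unfolded ell2_converges_def]])
      (use cmod_le_ell2_norm[OF ell2_diff[OF assms(2,3)]] in auto)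
  then show ?thesis by (simp add: LIM_zero_iff)
qed

lemma ell2_converges_unique:
  assumes "ell2_converges V s f" "ell2_converges V s g" "\<And>n. s n \<in> ell2 V" "f \<in> ell2 V" "g \<in> ell2 V"
  shows "f = g"
  by (rule ext, rule LIMSEQ_unique)
    (rule ell2_converges_pointwise[OF assms(1,3,4)], rule ell2_converges_pointwise[OF assms(2,3,5)])

lemma ell2_converges_inner:
  assumes s: "ell2_converges V s f" "\<And>n. s n \<in> ell2 V" and f: "f \<in> ell2 V" and g: "g \<in> ell2 V"
  shows "(\<lambda>n. ell2_inner V (s n) g) \<longlonglongrightarrow> ell2_inner V f g"
proof -
  have "(\<lambda>n. ell2_inner V (\<lambda>v. s n v - f v) g) \<longlonglongrightarrow> 0"
  proof (rule Lim_null_comparison[OF always_eventually])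
    show "\<forall>n. norm (ell2_inner V (\<lambda>v. s n v - f v) g) \<le> ell2_norm V (\<lambda>v. s n v - f v) * ell2_norm V g"
      using ell2_Cauchy_Schwarz[OF ell2_diff[OF s(2) f] g] by auto
    show "(\<lambda>n. ell2_norm V (\<lambda>v. s n v - f v) * ell2_norm V g) \<longlonglongrightarrow> 0"
      using s(1) tendsto_mult_left_zero by (auto simp: ell2_converges_def)
  qed
  then show ?thesis by (simp add: ell2_inner_diff s f g LIM_zero_iff)
qed

text \<open>A Cauchy sequence converges pointwise since evaluation is bounded. The Cauchy estimate restricted to a
  finite set of vertices survives the pointwise limit, and the bound does not depend on the finite set.\<close>

lemma ell2_complete:
  assumes s: "\<And>n. s n \<in> ell2 V"
    and cauchy: "\<And>e. e > 0 \<Longrightarrow> \<exists>N. \<forall>m\<ge>N. \<forall>n\<ge>N. ell2_norm V (\<lambda>v. s m v - s n v) \<le> e"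
  shows "\<exists>f\<in>ell2 V. ell2_converges V s f"
proof -
  have "Cauchy (\<lambda>n. s n v)" for v
  proof (rule CauchyI)
    fix e :: real assume "e > 0"
    then obtain N where N: "\<forall>m\<ge>N. \<forall>n\<ge>N. ell2_norm V (\<lambda>v. s m v - s n v) \<le> e / 2"
      using cauchy[of "e / 2"] by auto
    have "norm (s m v - s n v) < e" if "m \<ge> N" "n \<ge> N" for m n
      using cmod_le_ell2_norm[OF ell2_diff[OF s[of m] s[of n]], of v] N that \<open>e > 0\<close> by fastforce
    then show "\<exists>M. \<forall>m\<ge>M. \<forall>n\<ge>M. norm (s m v - s n v) < e" by blast
  qed
  then have lim: "(\<lambda>n. s n v) \<longlonglongrightarrow> lim (\<lambda>n. s n v)" for v
    using Cauchy_convergent_iff convergent_LIMSEQ_iff by blast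
  define f where "f v = lim (\<lambda>n. s n v)" for v
  have lim: "(\<lambda>n. s n v) \<longlonglongrightarrow> f v" for v using lim by (simp add: f_def)
  have off: "f v = 0" if "v \<notin> V" for v
    using LIMSEQ_unique[OF lim[of v]] ell2_off[OF s that] by auto
  have close: "(\<lambda>v. s n v - f v) \<in> ell2 V \<and> ell2_norm V (\<lambda>v. s n v - f v) \<le> e"
    if "e > 0" and N: "\<forall>m\<ge>N. \<forall>n\<ge>N. ell2_norm V (\<lambda>v. s m v - s n v) \<le> e" and "n \<ge> N" for n N e
  proof (rule ell2_bounded_partial_sums)
    fix F assume F: "finite F" "F \<subseteq> V"
    have "(\<lambda>m. L2_set (\<lambda>v. cmod (s n v - s m v)) F) \<longlonglongrightarrow> L2_set (\<lambda>v. cmod (s n v - f v)) F"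
      unfolding L2_set_def by (intro tendsto_intros lim)
    moreover have "L2_set (\<lambda>v. cmod (s n v - s m v)) F \<le> e" if "m \<ge> N" for m
      using L2_set_le_ell2_norm[OF ell2_diff[OF s[of n] s[of m]] F] N that \<open>n \<ge> N\<close> by fastforce
    ultimately show "L2_set (\<lambda>v. cmod (s n v - f v)) F \<le> e"
      by (intro LIMSEQ_le_const2[where a = e]) blast+
  qed (use off ell2_off[OF s] \<open>e > 0\<close> in auto)
  obtain N where "\<forall>m\<ge>N. \<forall>n\<ge>N. ell2_norm V (\<lambda>v. s m v - s n v) \<le> 1"
    using cauchy[of 1] by auto
  then have "(\<lambda>v. s N v - f v) \<in> ell2 V" using close[of 1 N N] by simp
  then have f: "f \<in> ell2 V" using ell2_diff[OF s[of N], of "\<lambda>v. s N v - f v"] by simp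
  have "(\<lambda>n. ell2_norm V (\<lambda>v. s n v - f v)) \<longlonglongrightarrow> 0"
  proof (rule LIMSEQ_I)
    fix r :: real assume "r > 0"
    then obtain N where "\<forall>m\<ge>N. \<forall>n\<ge>N. ell2_norm V (\<lambda>v. s m v - s n v) \<le> r / 2"
      using cauchy[of "r / 2"] by auto
    then have "\<forall>n\<ge>N. norm (ell2_norm V (\<lambda>v. s n v - f v) - 0) < r"
      using close[of "r / 2" N] \<open>r > 0\<close> by fastforce
    then show "\<exists>N. \<forall>n\<ge>N. norm (ell2_norm V (\<lambda>v. s n v - f v) - 0) < r" by blast
  qed
  then show ?thesis using f by (auto simp: ell2_converges_def)
qed

lemma closed_subspaceD:
  assumes "closed_subspace V X"
  shows "X \<subseteq> ell2 V" "(\<lambda>_. 0) \<in> X"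
    "f \<in> X \<Longrightarrow> g \<in> X \<Longrightarrow> (\<lambda>v. f v + g v) \<in> X" "f \<in> X \<Longrightarrow> (\<lambda>v. c * f v) \<in> X"
    "(\<And>k. s k \<in> X) \<Longrightarrow> f \<in> ell2 V \<Longrightarrow> ell2_converges V s f \<Longrightarrow> f \<in> X"
  using assms unfolding closed_subspace_def by simp_all (elim conjE, metis)

lemma closed_subspace_ell2: "closed_subspace V (ell2 V)"
  by (auto simp: closed_subspace_def ell2_add ell2_scale)

lemma closed_subspace_Inter:
  assumes "\<And>n. closed_subspace V (X n)"
  shows "closed_subspace V (\<Inter>n::nat. X n)"
proof -
  note * = closed_subspaceD[OF assms]
  show ?thesis
    unfolding closed_subspace_def 
  proof (intro conjI ballI allI impI)
    show "(\<Inter>n. X n) \<subseteq> ell2 V" using *(1)[of 0] by blast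
  next
    fix s f assume "\<forall>k. s k \<in> (\<Inter>n. X n)" "f \<in> ell2 V" "ell2_converges V s f"
    then show "f \<in> (\<Inter>n. X n)" using *(5)[of s _ f] by auto
  qed (use * in simp_all)
qed

lemma closed_subspace_orth_compl:
  assumes X: "X \<subseteq> ell2 V"
  shows "closed_subspace V (orth_compl V X)"
proof -
  have mem: "g \<in> orth_compl V X \<longleftrightarrow> g \<in> ell2 V \<and> (\<forall>f\<in>X. ell2_inner V g f = 0)" for g
    unfolding orth_compl_def using ell2_inner_eq_0_sym by blast
  show ?thesis
    unfolding closed_subspace_def
  proof (intro conjI ballI allI impI)
    fix f g assume "f \<in> orth_compl V X" "g \<in> orth_compl V X"
    then show "(\<lambda>v. f v + g v) \<in> orth_compl V X"
      using X by (simp add: mem ell2_add ell2_inner_add subset_eq)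
  next
    fix c f assume "f \<in> orth_compl V X"
    then show "(\<lambda>v. c * f v) \<in> orth_compl V X"
      by (simp add: mem ell2_scale ell2_inner_scale)
  next
    fix s g assume s: "\<forall>n. s n \<in> orth_compl V X" and g: "g \<in> ell2 V" "ell2_converges V s g"
    have "ell2_inner V g f = 0" if "f \<in> X" for f
    proof -
      have "(\<lambda>n. ell2_inner V (s n) f) \<longlonglongrightarrow> ell2_inner V g f"
        using s g that X by (intro ell2_converges_inner) (auto simp: mem)
      then show ?thesis using s that by (simp add: mem LIMSEQ_const_iff)
    qed
    then show "g \<in> orth_compl V X" using g by (simp add: mem)
  qed (auto simp: mem)
qed

section \<open>Bounded operators and adjoints\<close>

lemma bounded_operatorD:
  assumes "bounded_operator V T" "f \<in> ell2 V"
  shows "T f \<in> ell2 V" "g \<in> ell2 V \<Longrightarrow> T (\<lambda>v. f v + g v) = (\<lambda>v. T f v + T g v)"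
    "T (\<lambda>v. c * f v) = (\<lambda>v. c * T f v)"
  using assms by (simp_all add: bounded_operator_def)

lemma bounded_operator_bound:
  assumes "bounded_operator V T"
  obtains C where "C > 0" "\<And>f. f \<in> ell2 V \<Longrightarrow> ell2_norm V (T f) \<le> C * ell2_norm V f"
proof -
  obtain C where C: "\<And>f. f \<in> ell2 V \<Longrightarrow> ell2_norm V (T f) \<le> C * ell2_norm V f"
    using assms unfolding bounded_operator_def by blast
  have "ell2_norm V (T f) \<le> max C 1 * ell2_norm V f" if "f \<in> ell2 V" for f
    using C[OF that] mult_right_mono[of C "max C 1" "ell2_norm V f"] by simp
  then show ?thesis by (intro that[of "max C 1"]) auto
qed

lemma bounded_operator_diff:
  assumes "bounded_operator V T" "f \<in> ell2 V" "g \<in> ell2 V"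
  shows "T (\<lambda>v. f v - g v) = (\<lambda>v. T f v - T g v)"
proof -
  have "T (\<lambda>v. f v + - 1 * g v) = (\<lambda>v. T f v + T (\<lambda>v. - 1 * g v) v)"
    by (rule bounded_operatorD(2)[OF assms(1,2) ell2_scale[OF assms(3)]])
  also have "T (\<lambda>v. - 1 * g v) = (\<lambda>v. - 1 * T g v)"
    by (rule bounded_operatorD(3)[OF assms(1,3)])
  finally show ?thesis by simp
qed

lemma bounded_operator_converges:
  assumes T: "bounded_operator V T" and s: "ell2_converges V s f" "\<And>n. s n \<in> ell2 V" "f \<in> ell2 V"
  shows "ell2_converges V (\<lambda>n. T (s n)) (T f)"
proof -
  obtain C where C: "\<And>f. f \<in> ell2 V \<Longrightarrow> ell2_norm V (T f) \<le> C * ell2_norm V f"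
    using bounded_operator_bound[OF T] by blast
  show ?thesis
    unfolding ell2_converges_def
  proof (rule Lim_null_comparison[OF always_eventually])
    show "\<forall>n. norm (ell2_norm V (\<lambda>v. T (s n) v - T f v)) \<le> C * ell2_norm V (\<lambda>v. s n v - f v)"
      using C[OF ell2_diff[OF s(2,3)]] by (simp add: bounded_operator_diff[OF T s(2,3)])
    show "(\<lambda>n. C * ell2_norm V (\<lambda>v. s n v - f v)) \<longlonglongrightarrow> 0"
      using s(1) tendsto_mult_right_zero by (auto simp: ell2_converges_def)
  qed
qed

text \<open>If \<open>T x\<^sub>n\<close> converges to \<open>y\<close>, then \<open>x\<^sub>n = L (T x\<^sub>n)\<close> converges to \<open>L y\<close> for a bounded left
  inverse \<open>L\<close>, so \<open>y = T (L y)\<close>.\<close>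

lemma closed_subspace_image:
  assumes T: "bounded_operator V T" and "left_invertible V T" and X: "closed_subspace V X"
  shows "closed_subspace V (T ` X)"
proof -
  obtain L where L: "bounded_operator V L" "\<And>f. f \<in> ell2 V \<Longrightarrow> L (T f) = f"
    using assms(2) by (auto simp: left_invertible_def)
  note Xl = closed_subspaceD[OF X]
  note Tl = bounded_operatorD[OF T subsetD[OF Xl(1)]]
  have T0: "T (\<lambda>_. 0) = (\<lambda>_. 0)" using Tl(3)[OF Xl(2), of 0] by simp
  have lim: "y \<in> T ` X" if s: "\<And>n. s n \<in> T ` X" "y \<in> ell2 V" "ell2_converges V s y" for s y
  proof -
    define x where "x n = L (s n)" for n
    have x: "x n \<in> X \<and> T (x n) = s n" for n
    proof -
      obtain a where "a \<in> X" "s n = T a" using s(1)[of n] by blast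
      then show ?thesis using L(2)[of a] Xl(1) by (auto simp: x_def)
    qed
    have sl: "s n \<in> ell2 V" for n using Tl(1)[of "x n"] x[of n] by simp
    have Ly: "L y \<in> ell2 V" using L(1) s(2) by (simp add: bounded_operator_def)
    have xL: "ell2_converges V x (L y)"
      using bounded_operator_converges[OF L(1) s(3) sl s(2)] by (simp add: x_def[abs_def])
    have "ell2_converges V s (T (L y))"
      using bounded_operator_converges[OF T xL subsetD[OF Xl(1)] Ly] x by simp
    then have "y = T (L y)"
      by (rule ell2_converges_unique[OF s(3) _ sl s(2) bounded_operatorD(1)[OF T Ly]])
    moreover have "L y \<in> X" by (rule Xl(5)[OF _ Ly xL]) (use x in blast)
    ultimately show ?thesis by blast
  qed
  show ?thesis
    unfolding closed_subspace_def
  proof (intro conjI ballI allI impI)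
    show "T ` X \<subseteq> ell2 V" using Tl(1) by blast
    show "(\<lambda>_. 0) \<in> T ` X" by (rule image_eqI[where f = T, OF T0[symmetric] Xl(2)])
  next
    fix f g assume "f \<in> T ` X" "g \<in> T ` X"
    then obtain a b where "a \<in> X" "f = T a" "b \<in> X" "g = T b" by blast
    then show "(\<lambda>v. f v + g v) \<in> T ` X"
      using Tl(2)[of a b] Xl(3)[of a b] Xl(1) by (auto intro!: image_eqI[where x = "\<lambda>v. a v + b v"])
  next
    fix c f assume "f \<in> T ` X"
    then obtain a where "a \<in> X" "f = T a" by blast
    then show "(\<lambda>v. c * f v) \<in> T ` X"
      using Tl(3)[of a c] Xl(4)[of a c] by (auto intro!: image_eqI[where x = "\<lambda>v. c * a v"])
  qed (use lim in blast)
qed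

lemma finite_support_image:
  assumes T: "bounded_operator V T" and "finite F" "F \<subseteq> V"
  shows "T (\<lambda>v. if v \<in> F then f v else 0) = (\<lambda>v. \<Sum>u\<in>F. f u * T (basis_vec u) v)"
  using assms(2,3)
proof (induction F)
  case empty
  have "T (\<lambda>v. 0 * 0) = (\<lambda>v. 0 * T (\<lambda>_. 0) v)"
    by (rule bounded_operatorD(3)[OF T ell2_zero])
  then show ?case by simp
next
  case (insert u F)
  let ?r = "\<lambda>v. if v \<in> F then f v else 0"
  have eq: "(\<lambda>v. if v \<in> insert u F then f v else 0) = (\<lambda>v. f u * basis_vec u v + ?r v)"
    using insert.hyps by (auto simp: basis_vec_apply)
  have "T (\<lambda>v. f u * basis_vec u v + ?r v) = (\<lambda>v. T (\<lambda>v. f u * basis_vec u v) v + T ?r v)"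
    by (rule bounded_operatorD(2)[OF T])
      (use insert in \<open>auto intro!: ell2_scale basis_vec_ell2 ell2_finite_support(1)\<close>)
  also have "T (\<lambda>v. f u * basis_vec u v) = (\<lambda>v. f u * T (basis_vec u) v)"
    by (rule bounded_operatorD(3)[OF T basis_vec_ell2]) (use insert.prems in auto)
  finally show ?case unfolding eq using insert by simp
qed

lemma ell2_inner_sum:
  assumes "finite F" "\<And>u. u \<in> F \<Longrightarrow> x u \<in> ell2 V" "g \<in> ell2 V"
  shows "(\<lambda>v. \<Sum>u\<in>F. x u v) \<in> ell2 V \<and>
    ell2_inner V (\<lambda>v. \<Sum>u\<in>F. x u v) g = (\<Sum>u\<in>F. ell2_inner V (x u) g)"
  using assms by (induction F) (auto simp: ell2_inner_add ell2_add)

lemma ell2_truncation_tendsto: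
  assumes f: "f \<in> ell2 V"
  shows "((\<lambda>F. ell2_norm V (\<lambda>v. f v - (if v \<in> F then f v else 0))) \<longlongrightarrow> 0) (finite_subsets_at_top V)"
proof -
  let ?n = "\<lambda>v. (cmod (f v))\<^sup>2"
  have sm: "?n summable_on V" using f by (simp add: ell2_def)
  then have "((\<lambda>F. sum ?n F) \<longlongrightarrow> infsum ?n V) (finite_subsets_at_top V)"
    using has_sum_infsum has_sum_def by blast
  then have "((\<lambda>F. sqrt (infsum ?n V - sum ?n F)) \<longlongrightarrow> sqrt (infsum ?n V - infsum ?n V)) (finite_subsets_at_top V)"
    by (intro tendsto_intros)
  then have lim: "((\<lambda>F. sqrt (infsum ?n V - sum ?n F)) \<longlongrightarrow> 0) (finite_subsets_at_top V)" by simp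
  have "ell2_norm V (\<lambda>v. f v - (if v \<in> F then f v else 0)) = sqrt (infsum ?n V - sum ?n F)"
    if F: "finite F" "F \<subseteq> V" for F
  proof -
    have "(\<Sum>\<^sub>\<infinity>v\<in>V. (cmod (f v - (if v \<in> F then f v else 0)))\<^sup>2) = infsum ?n (V - F)"
      by (rule infsum_cong_neutral) auto
    also have "\<dots> = infsum ?n V - infsum ?n F"
      by (rule infsum_Diff[OF sm _ F(2)]) (simp add: F(1))
    finally show ?thesis using F(1) by (simp add: ell2_norm_def)
  qed
  then show ?thesis
    by (intro tendsto_cong[THEN iffD1, OF _ lim] eventually_finite_subsets_at_top_weakI) simp
qed

text \<open>The coordinates of the adjoint vector are forced: \<open>h(u) = \<langle>g, T e\<^sub>u\<rangle>\<close>. Testing \<open>T\<close> on the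
  truncation of \<open>h\<close> to a finite set bounds the norm of that truncation by \<open>C \<parallel>g\<parallel>\<close>, so \<open>h\<close> is
  square summable; the adjoint identity holds on finitely supported \<open>f\<close> by linearity and extends by
  continuity.\<close>

lemma adjoint_exists:
  assumes T: "bounded_operator V T" and g: "g \<in> ell2 V"
  shows "\<exists>h\<in>ell2 V. \<forall>f\<in>ell2 V. ell2_inner V (T f) g = ell2_inner V f h"
proof -
  obtain C where C: "C > 0" "\<And>f. f \<in> ell2 V \<Longrightarrow> ell2_norm V (T f) \<le> C * ell2_norm V f"
    using bounded_operator_bound[OF T] by blast
  have Tl: "T f \<in> ell2 V" if "f \<in> ell2 V" for f using T that by (simp add: bounded_operator_def)
  define h where "h u = (if u \<in> V then ell2_inner V g (T (basis_vec u)) else 0)" for u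
  have trunc: "ell2_inner V (T (\<lambda>v. if v \<in> F then f v else 0)) g = (\<Sum>u\<in>F. f u * cnj (h u))"
    if F: "finite F" "F \<subseteq> V" for F f
  proof -
    have "ell2_inner V (\<lambda>v. \<Sum>u\<in>F. f u * T (basis_vec u) v) g
        = (\<Sum>u\<in>F. ell2_inner V (\<lambda>v. f u * T (basis_vec u) v) g)"
      by (rule ell2_inner_sum[THEN conjunct2, OF F(1) _ g])
        (use F in \<open>auto intro!: ell2_scale Tl basis_vec_ell2\<close>)
    also have "\<dots> = (\<Sum>u\<in>F. f u * cnj (h u))"
      by (rule sum.cong) (use F in \<open>auto simp: ell2_inner_scale h_def ell2_inner_cnj[of V _ g]\<close>)
    finally show ?thesis by (simp add: finite_support_image[OF T F])
  qed
  have hl: "h \<in> ell2 V \<and> ell2_norm V h \<le> C * ell2_norm V g"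
  proof (rule ell2_bounded_partial_sums)
    fix F assume F: "finite F" "F \<subseteq> V"
    let ?hF = "\<lambda>v. if v \<in> F then h v else 0" and ?l = "L2_set (\<lambda>v. cmod (h v)) F"
    note hF = ell2_finite_support[OF F, of h]
    have "ell2_inner V (T ?hF) g = complex_of_real (\<Sum>u\<in>F. (cmod (h u))\<^sup>2)"
      unfolding trunc[OF F] by (simp add: complex_norm_square del: of_real_power)
    also have "(\<Sum>u\<in>F. (cmod (h u))\<^sup>2) = ?l\<^sup>2" by (simp add: L2_set_def sum_nonneg)
    finally have "?l\<^sup>2 = cmod (ell2_inner V (T ?hF) g)" by (simp add: norm_power)
    also have "\<dots> \<le> ell2_norm V (T ?hF) * ell2_norm V g" by (rule ell2_Cauchy_Schwarz[OF Tl[OF hF(1)] g])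
    also have "\<dots> \<le> C * ?l * ell2_norm V g"
      using C(2)[OF hF(1)] by (intro mult_right_mono) (auto simp: hF(2))
    finally have "?l * ?l \<le> ?l * (C * ell2_norm V g)" by (simp add: power2_eq_square mult_ac)
    then show "?l \<le> C * ell2_norm V g"
      using L2_set_nonneg[of "\<lambda>v. cmod (h v)" F] C(1)
      by (cases "?l = 0") (auto simp: mult_le_cancel_left)
  qed (use C in \<open>auto simp: h_def\<close>)
  have "ell2_inner V (T f) g = ell2_inner V f h" if f: "f \<in> ell2 V" for f
  proof -
    let ?t = "\<lambda>F v. if v \<in> F then f v else 0"
    have "((\<lambda>F. \<Sum>u\<in>F. f u * cnj (h u)) \<longlongrightarrow> ell2_inner V (T f) g) (finite_subsets_at_top V)"
    proof (rule LIM_zero_cancel, rule Lim_null_comparison)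
      show "\<forall>\<^sub>F F in finite_subsets_at_top V. norm ((\<Sum>u\<in>F. f u * cnj (h u)) - ell2_inner V (T f) g)
          \<le> C * ell2_norm V (\<lambda>v. f v - ?t F v) * ell2_norm V g"
      proof (rule eventually_finite_subsets_at_top_weakI)
        fix F assume F: "finite F" "F \<subseteq> V"
        note t = ell2_finite_support(1)[OF F, of f]
        have "ell2_inner V (T f) g - (\<Sum>u\<in>F. f u * cnj (h u)) = ell2_inner V (T (\<lambda>v. f v - ?t F v)) g"
          unfolding bounded_operator_diff[OF T f t] trunc[OF F, symmetric]
          by (simp add: ell2_inner_diff Tl f t g)
        moreover have "cmod \<dots> \<le> ell2_norm V (T (\<lambda>v. f v - ?t F v)) * ell2_norm V g"
          by (intro ell2_Cauchy_Schwarz Tl ell2_diff f t g)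
        moreover have "\<dots> \<le> C * ell2_norm V (\<lambda>v. f v - ?t F v) * ell2_norm V g"
          by (intro mult_right_mono C(2) ell2_diff f t) simp
        ultimately show "norm ((\<Sum>u\<in>F. f u * cnj (h u)) - ell2_inner V (T f) g)
          \<le> C * ell2_norm V (\<lambda>v. f v - ?t F v) * ell2_norm V g"
          by (metis (no_types, lifting) norm_minus_commute order_trans)
      qed
      show "((\<lambda>F. C * ell2_norm V (\<lambda>v. f v - ?t F v) * ell2_norm V g) \<longlongrightarrow> 0) (finite_subsets_at_top V)"
        by (intro tendsto_mult_left_zero tendsto_mult_right_zero ell2_truncation_tendsto f)
    qed
    then have "((\<lambda>u. f u * cnj (h u)) has_sum ell2_inner V (T f) g) V" by (simp add: has_sum_def)
    then show ?thesis by (simp add: ell2_inner_def infsumI)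
  qed
  then show ?thesis using hl by blast
qed

lemma adjoint:
  assumes T: "bounded_operator V T" and g: "g \<in> ell2 V"
  shows "adj V T g \<in> ell2 V" "f \<in> ell2 V \<Longrightarrow> ell2_inner V (T f) g = ell2_inner V f (adj V T g)"
proof -
  obtain h where h: "h \<in> ell2 V" "\<forall>f\<in>ell2 V. ell2_inner V (T f) g = ell2_inner V f h"
    using adjoint_exists[OF assms] by blast
  have "k = h" if k: "k \<in> ell2 V" "\<forall>f\<in>ell2 V. ell2_inner V (T f) g = ell2_inner V f k" for k
  proof
    fix u show "k u = h u"
    proof (cases "u \<in> V")
      case True
      have "ell2_inner V (basis_vec u) k = ell2_inner V (basis_vec u) h"
        using basis_vec_ell2[OF True] h k by metis
      then show ?thesis
        using ell2_inner_basis_vec[OF True] ell2_inner_cnj[of V k] ell2_inner_cnj[of V h] by metis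
    qed (simp add: ell2_off[OF h(1)] ell2_off[OF k(1)])
  qed
  then have eq: "adj V T g = h"
    unfolding adj_def using h by (intro the_equality conjI) blast+
  show "adj V T g \<in> ell2 V" using h(1) by (simp only: eq)
  show "ell2_inner V (T f) g = ell2_inner V f (adj V T g)" if "f \<in> ell2 V"
    using h(2) that by (simp only: eq)
qed

lemma adj_apply:
  assumes T: "bounded_operator V T" and g: "g \<in> ell2 V" and u: "u \<in> V"
  shows "adj V T g u = ell2_inner V g (T (basis_vec u))"
proof -
  have "adj V T g u = ell2_inner V (adj V T g) (basis_vec u)"
    by (rule ell2_inner_basis_vec[OF u, symmetric])
  also have "\<dots> = cnj (ell2_inner V (basis_vec u) (adj V T g))" by (rule ell2_inner_cnj)
  also have "\<dots> = cnj (ell2_inner V (T (basis_vec u)) g)"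
    by (simp only: adjoint(2)[OF T g basis_vec_ell2[OF u]])
  also have "\<dots> = ell2_inner V g (T (basis_vec u))" by (rule ell2_inner_cnj[symmetric])
  finally show ?thesis .
qed

text \<open>Since \<open>adj\<close> is a definite description, this description of the kernel relies on the existence of the
  adjoint.\<close>

lemma ker_adj:
  assumes T: "bounded_operator V T"
  shows "ker V (adj V T) = orth_compl V (T ` ell2 V)"
proof -
  have "adj V T g = (\<lambda>_. 0) \<longleftrightarrow> (\<forall>f\<in>ell2 V. ell2_inner V (T f) g = 0)" if g: "g \<in> ell2 V" for g
  proof
    assume 0: "adj V T g = (\<lambda>_. 0)"
    show "\<forall>f\<in>ell2 V. ell2_inner V (T f) g = 0"
    proof
      fix f assume "f \<in> ell2 V"
      then have "ell2_inner V (T f) g = ell2_inner V f (adj V T g)" by (rule adjoint(2)[OF T g])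
      then show "ell2_inner V (T f) g = 0" by (simp add: 0)
    qed
  next
    assume "\<forall>f\<in>ell2 V. ell2_inner V (T f) g = 0"
    then have "ell2_inner V (T (adj V T g)) g = 0" using adjoint(1)[OF T g] by blast
    then show "adj V T g = (\<lambda>_. 0)"
      using adjoint(2)[OF T g adjoint(1)[OF T g]] by (intro ell2_inner_self_eq_0[where V = V] adjoint(1)[OF T g]) simp
  qed
  then show ?thesis unfolding ker_def orth_compl_def by blast
qed

section \<open>Weighted shifts on leafless, rootless trees\<close>

locale tree_shift =
  fixes V :: "'v set" and E :: "('v \<times> 'v) set" and w :: "'v \<Rightarrow> real"
  assumes tree: "directed_tree V E" and leafless: "leafless V E" and rootless: "rootless V E"
    and weight_pos: "v \<in> V \<Longrightarrow> w v > 0"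
    and bounded: "bounded_operator V (weighted_shift V E w)"
    and left_inv: "left_invertible V (weighted_shift V E w)"
begin

abbreviation S where "S \<equiv> weighted_shift V E w"

abbreviation M where "M \<equiv> hyperrange V S"

abbreviation K where "K \<equiv> ker V (adj V S)"

lemma par_eq: "(u, v) \<in> E \<Longrightarrow> par E v = u"
  using tree unfolding par_def directed_tree_def by blast

lemma edge_in: "(u, v) \<in> E \<Longrightarrow> u \<in> V \<and> v \<in> V"
  using tree by (auto simp: directed_tree_def)

lemma par_in:
  assumes "v \<in> V"
  shows "par E v \<in> V"
proof -
  obtain u where "(u, v) \<in> E" using rootless assms by (auto simp: rootless_def)
  then show ?thesis using par_eq edge_in by metis
qed

lemma par_pow_in: "v \<in> V \<Longrightarrow> (par E ^^ n) v \<in> V"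
  by (induction n) (auto simp: par_in)

lemma child_exists:
  assumes "u \<in> V"
  shows "\<exists>v\<in>V. par E v = u"
proof -
  obtain v where "(u, v) \<in> E" using leafless assms by (auto simp: leafless_def)
  then show ?thesis using par_eq edge_in by metis
qed

lemma common_ancestor:
  assumes "u \<in> V" "v \<in> V"
  shows "\<exists>m n. (par E ^^ m) u = (par E ^^ n) v"
proof -
  have "(u, v) \<in> (E \<union> E\<inverse>)\<^sup>*" using tree assms by (simp add: directed_tree_def)
  then show ?thesis
  proof (induction rule: rtrancl_induct)
    case (step y z)
    then obtain m n where mn: "(par E ^^ m) u = (par E ^^ n) y" by blast
    from step.hyps(2) consider "par E z = y" | "par E y = z" using par_eq by blast
    then show ?case
    proof cases
      case 1
      then have "(par E ^^ m) u = (par E ^^ Suc n) z" using mn by (simp add: funpow_swap1)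
      then show ?thesis by blast
    next
      case 2
      then have "(par E ^^ Suc m) u = (par E ^^ n) z" using mn by (simp add: funpow_swap1)
      then show ?thesis by blast
    qed
  qed blast
qed

lemma same_generation_of_par:
  assumes "same_generation E (par E u) (par E v)"
  shows "same_generation E u v"
proof -
  obtain n where "(par E ^^ n) (par E u) = (par E ^^ n) (par E v)"
    using assms by (auto simp: same_generation_def)
  then have "(par E ^^ Suc n) u = (par E ^^ Suc n) v" by (simp add: funpow_swap1)
  then show ?thesis unfolding same_generation_def by blast
qed

section \<open>Ranges of powers and the hyperrange\<close>

lemma shift_apply: "v \<in> V \<Longrightarrow> S f v = complex_of_real (w v) * f (par E v)"
  by (simp add: weighted_shift_def)

lemma shift_ell2: "f \<in> ell2 V \<Longrightarrow> S f \<in> ell2 V"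
  by (rule bounded_operatorD(1)[OF bounded])

lemma shift_inj: "f \<in> ell2 V \<Longrightarrow> g \<in> ell2 V \<Longrightarrow> S f = S g \<Longrightarrow> f = g"
  using left_inv unfolding left_invertible_def by metis

lemma image_Suc: "(S ^^ Suc n) ` X = S ` ((S ^^ n) ` X)"
  by (simp add: image_comp)

lemma closed_subspace_pow_image: "closed_subspace V X \<Longrightarrow> closed_subspace V ((S ^^ n) ` X)"
proof (induction n)
  case (Suc n)
  then show ?case unfolding image_Suc by (intro closed_subspace_image[OF bounded left_inv])
qed simp

lemma pow_ell2: "f \<in> ell2 V \<Longrightarrow> (S ^^ n) f \<in> ell2 V"
  using closed_subspaceD(1)[OF closed_subspace_pow_image[OF closed_subspace_ell2]] by blast

lemma pow_range_ell2: "(S ^^ n) ` ell2 V \<subseteq> ell2 V"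
  using pow_ell2 by (rule image_subsetI)

lemma pow_range_antimono: "m \<le> n \<Longrightarrow> (S ^^ n) ` ell2 V \<subseteq> (S ^^ m) ` ell2 V"
proof (induction rule: dec_induct)
  case (step n)
  have "(S ^^ Suc n) ` ell2 V \<subseteq> (S ^^ n) ` ell2 V"
    unfolding funpow_Suc_right image_comp[symmetric] using shift_ell2 by blast
  then show ?case using step by blast
qed simp

lemma closed_subspace_hyperrange: "closed_subspace V M"
  unfolding hyperrange_def by (rule closed_subspace_Inter[OF closed_subspace_pow_image[OF closed_subspace_ell2]])

lemma hyperrange_ell2: "M \<subseteq> ell2 V"
  by (rule closed_subspaceD(1)[OF closed_subspace_hyperrange])

text \<open>Injectivity makes the preimages under the various powers of \<open>S\<close> agree, so an element of the
  hyperrange has a preimage which lies again in the hyperrange.\<close>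

lemma shift_hyperrange: "S ` M = M"
proof
  show "S ` M \<subseteq> M"
  proof
    fix g assume "g \<in> S ` M"
    then obtain f where f: "f \<in> M" "g = S f" by blast
    have "g \<in> (S ^^ n) ` ell2 V" for n
    proof -
      have "f \<in> (S ^^ n) ` ell2 V" using f(1) by (auto simp: hyperrange_def)
      then have "g \<in> (S ^^ Suc n) ` ell2 V" unfolding image_Suc f(2) by blast
      then show ?thesis using pow_range_antimono[of n "Suc n"] by auto
    qed
    then show "g \<in> M" by (simp add: hyperrange_def)
  qed
  show "M \<subseteq> S ` M"
  proof
    fix g assume g: "g \<in> M"
    then have pow: "g \<in> S ` ((S ^^ n) ` ell2 V)" for n
      unfolding hyperrange_def image_Suc[symmetric] by blast
    then obtain f where f: "f \<in> ell2 V" "g = S f" using pow[of 0] by auto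
    have "f \<in> (S ^^ n) ` ell2 V" for n
    proof -
      obtain x where x: "x \<in> (S ^^ n) ` ell2 V" "g = S x" using pow by blast
      then have "x \<in> ell2 V" using pow_ell2 by blast
      then show ?thesis using shift_inj[OF f(1)] f(2) x by metis
    qed
    then show "g \<in> S ` M" using f(2) by (auto simp: hyperrange_def)
  qed
qed

lemma shift_preimage_hyperrange:
  assumes "f \<in> M"
  obtains h where "h \<in> M" "f = S h"
  using assms shift_hyperrange by (metis imageE)

text \<open>By induction on the distance to a common ancestor, where \<open>u = v\<close>: writing \<open>f = S f'\<close> and
  \<open>g = S g'\<close> within the hyperrange reduces the identity to the parents, since both sides acquire the
  same factor \<open>w(u) w(v)\<close>.\<close>

lemma hyperrange_proportional:
  assumes "same_generation E u v" "u \<in> V" "v \<in> V" "f \<in> M" "g \<in> M"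
  shows "f u * g v = f v * g u"
proof -
  obtain n where "(par E ^^ n) u = (par E ^^ n) v" using assms(1) by (auto simp: same_generation_def)
  then show ?thesis using assms(2-)
  proof (induction n arbitrary: u v f g)
    case 0
    then show ?case by simp
  next
    case (Suc n)
    obtain f' g' where fg: "f' \<in> M" "f = S f'" "g' \<in> M" "g = S g'"
      using shift_preimage_hyperrange Suc.prems(4,5) by metis
    have "f' (par E u) * g' (par E v) = f' (par E v) * g' (par E u)"
      using Suc.prems(1) fg by (intro Suc.IH) (auto simp: par_in Suc.prems funpow_swap1)
    then show ?case
      using Suc.prems(2,3) by (simp add: fg shift_apply)
  qed
qed

text \<open>The next two lemmas move a nonzero value of an element of the hyperrange to an ancestor (by inverting
  \<open>S\<close>) and to a descendant (by applying \<open>S\<close>); connectedness of the tree then reaches every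
  vertex.\<close>

lemma hyperrange_ascend:
  assumes "f \<in> M" "v \<in> V" "f v \<noteq> 0"
  shows "\<exists>g\<in>M. g ((par E ^^ n) v) \<noteq> 0"
proof (induction n)
  case (Suc n)
  then obtain g where g: "g \<in> M" "g ((par E ^^ n) v) \<noteq> 0" by blast
  obtain h where "h \<in> M" "g = S h" using shift_preimage_hyperrange g(1) .
  then have "h ((par E ^^ Suc n) v) \<noteq> 0"
    using g(2) shift_apply[OF par_pow_in[OF assms(2)], of h n] by auto
  then show ?case using \<open>h \<in> M\<close> by blast
qed (use assms in auto)

lemma hyperrange_descend:
  assumes "f \<in> M" "v \<in> V" "f ((par E ^^ n) v) \<noteq> 0"
  shows "\<exists>g\<in>M. g v \<noteq> 0"
  using assms
proof (induction n arbitrary: f)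
  case (Suc n)
  have "S f \<in> M" using Suc.prems(1) shift_hyperrange by blast
  moreover have "S f ((par E ^^ n) v) \<noteq> 0"
    using Suc.prems(3) weight_pos[OF par_pow_in[OF Suc.prems(2)], of n]
    by (simp add: shift_apply[OF par_pow_in[OF Suc.prems(2)]])
  ultimately show ?case using Suc.IH Suc.prems(2) by blast
qed auto

lemma hyperrange_nonvanishing:
  assumes "\<not> analytic_operator V S" "u \<in> V"
  shows "\<exists>f\<in>M. f u \<noteq> 0"
proof -
  obtain f v where f: "f \<in> M" "f v \<noteq> 0"
    using assms(1) closed_subspaceD(2)[OF closed_subspace_hyperrange]
    unfolding analytic_operator_def by fastforce
  have v: "v \<in> V" using ell2_off[OF subsetD[OF hyperrange_ell2 f(1)], of v] f(2) by blast
  obtain m n where "(par E ^^ m) u = (par E ^^ n) v" using common_ancestor[OF assms(2) v] by blast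
  then show ?thesis
    using hyperrange_ascend[OF f(1) v f(2), of n] hyperrange_descend[OF _ assms(2), of _ m] by auto
qed

section \<open>The diagonal operator \<open>S\<^sup>* S\<close>\<close>

text \<open>The diagonal entry of \<open>S\<^sup>* S\<close> at \<open>u\<close>, that is, the sum of the squared weights of the children of
  \<open>u\<close>.\<close>

definition col_sq :: "'v \<Rightarrow> real" where
  "col_sq u = (ell2_norm V (S (basis_vec u)))\<^sup>2"

lemma col_sq_nonneg: "0 \<le> col_sq u"
  by (simp add: col_sq_def)

text \<open>Column \<open>S e\<^sub>u\<close> lives on the children of \<open>u\<close>, where \<open>S f\<close> is \<open>f(u)\<close> times that column.\<close>

lemma adj_shift_shift:
  assumes f: "f \<in> ell2 V"
  shows "adj V S (S f) = (\<lambda>u. complex_of_real (col_sq u) * f u)"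
proof
  fix u
  show "adj V S (S f) u = complex_of_real (col_sq u) * f u"
  proof (cases "u \<in> V")
    case True
    let ?e = "S (basis_vec u)"
    have pointwise: "(\<lambda>v. S f v * cnj (?e v)) = (\<lambda>v. f u * (?e v * cnj (?e v)))"
      by (rule ext) (simp add: weighted_shift_def basis_vec_apply)
    have "ell2_inner V (S f) ?e = f u * ell2_inner V ?e ?e"
      unfolding ell2_inner_def pointwise by (rule infsum_cmult_right')
    also have "\<dots> = f u * complex_of_real (col_sq u)"
      by (simp add: ell2_inner_self shift_ell2 basis_vec_ell2 True col_sq_def)
    finally show ?thesis
      by (simp add: adj_apply[OF bounded shift_ell2[OF f] True])
  next
    case False
    then show ?thesis using ell2_off[OF f] ell2_off[OF adjoint(1)[OF bounded shift_ell2[OF f]]] by simp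
  qed
qed

lemma inner_shift_shift:
  assumes "f \<in> ell2 V" "g \<in> ell2 V"
  shows "ell2_inner V (S f) (S g) = ell2_inner V (\<lambda>u. complex_of_real (col_sq u) * f u) g"
proof -
  have "ell2_inner V (S g) (S f) = ell2_inner V g (adj V S (S f))"
    by (rule adjoint(2)[OF bounded shift_ell2[OF assms(1)] assms(2)])
  then show ?thesis
    unfolding adj_shift_shift[OF assms(1)] by (metis ell2_inner_cnj)
qed

text \<open>The lower bound comes from the left inverse. It makes division by \<open>col_sq\<close> a bounded operation,
  which gives the inverse of \<open>S\<^sup>* S\<close> later.\<close>

lemma col_sq_bounds:
  obtains b B where "0 < b" "0 < B" "\<And>u. u \<in> V \<Longrightarrow> b \<le> col_sq u \<and> col_sq u \<le> B"
proof -
  obtain C where C: "C > 0" "\<And>f. f \<in> ell2 V \<Longrightarrow> ell2_norm V (S f) \<le> C * ell2_norm V f"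
    using bounded_operator_bound[OF bounded] by blast
  obtain L where L: "bounded_operator V L" "\<And>f. f \<in> ell2 V \<Longrightarrow> L (S f) = f"
    using left_inv by (auto simp: left_invertible_def)
  obtain D where D: "D > 0" "\<And>f. f \<in> ell2 V \<Longrightarrow> ell2_norm V (L f) \<le> D * ell2_norm V f"
    using bounded_operator_bound[OF L(1)] by blast
  have "(1 / D)\<^sup>2 \<le> col_sq u \<and> col_sq u \<le> C\<^sup>2" if u: "u \<in> V" for u
  proof -
    note e = basis_vec_ell2[OF u]
    have "1 \<le> D * ell2_norm V (S (basis_vec u))"
      using D(2)[OF shift_ell2[OF e]] by (simp add: L(2)[OF e] ell2_norm_basis_vec[OF u])
    then have "1 / D \<le> ell2_norm V (S (basis_vec u))" using D(1) by (simp add: field_simps)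
    moreover have "ell2_norm V (S (basis_vec u)) \<le> C"
      using C(2)[OF e] by (simp add: ell2_norm_basis_vec[OF u])
    ultimately show ?thesis using D(1) unfolding col_sq_def by (intro conjI power_mono) auto
  qed
  then show ?thesis using C(1) D(1) by (intro that[of "(1 / D)\<^sup>2" "C\<^sup>2"]) auto
qed

lemma balanced_col_sq:
  "balanced V E w \<longleftrightarrow> (\<forall>u\<in>V. \<forall>v\<in>V. same_generation E u v \<longrightarrow> col_sq u = col_sq v)"
  unfolding balanced_def col_sq_def by (simp add: power2_eq_iff_nonneg)

section \<open>Reducing hyperranges force balance\<close>

lemma balanced_if_reduces:
  assumes "\<not> analytic_operator V S" and red: "reduces V M S"
  shows "balanced V E w"
  unfolding balanced_col_sq
proof (intro ballI impI)
  fix u v assume u: "u \<in> V" and v: "v \<in> V" and uv: "same_generation E u v"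
  show "col_sq u = col_sq v"
  proof (cases "u = v")
    case False
    obtain f where f: "f \<in> M" "f u \<noteq> 0" using hyperrange_nonvanishing assms(1) u by blast
    have f2: "f \<in> ell2 V" using f hyperrange_ell2 by blast
    have fv: "f v \<noteq> 0"
    proof
      assume "f v = 0"
      obtain h where "h \<in> M" "h v \<noteq> 0" using hyperrange_nonvanishing assms(1) v by blast
      then show False using hyperrange_proportional[OF uv u v f(1), of h] f(2) \<open>f v = 0\<close> by simp
    qed
    \<comment> \<open>Up to scaling, the vector supported on \<open>{u, v}\<close> that is orthogonal to \<open>f\<close>; by
      proportionality it is then orthogonal to the whole hyperrange.\<close>
    define g where "g x = cnj (f v) * basis_vec u x - cnj (f u) * basis_vec v x" for x
    note bu = ell2_scale[OF basis_vec_ell2[OF u]] and bv = ell2_scale[OF basis_vec_ell2[OF v]]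
    have g: "g \<in> ell2 V" unfolding g_def[abs_def] by (intro ell2_diff bu bv)
    have inner_g: "ell2_inner V h g = f v * h u - f u * h v" if h: "h \<in> ell2 V" for h
    proof -
      have "ell2_inner V g h = cnj (f v) * ell2_inner V (basis_vec u) h - cnj (f u) * ell2_inner V (basis_vec v) h"
        unfolding g_def[abs_def] by (simp add: ell2_inner_diff[OF bu bv h] ell2_inner_scale)
      then have "cnj (ell2_inner V g h) = f v * ell2_inner V h (basis_vec u) - f u * ell2_inner V h (basis_vec v)"
        by (simp flip: ell2_inner_cnj)
      then show ?thesis by (simp add: ell2_inner_basis_vec u v flip: ell2_inner_cnj)
    qed
    have "ell2_inner V h g = 0" if "h \<in> M" for h
      using inner_g[of h] hyperrange_proportional[OF uv u v f(1) that] that hyperrange_ell2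
      by (auto simp: mult.commute)
    then have "g \<in> orth_compl V M" using g by (simp add: orth_compl_def)
    then have "S g \<in> orth_compl V M" using red by (auto simp: reduces_def)
    moreover have "S f \<in> M" using f shift_hyperrange by blast
    ultimately have "ell2_inner V (S f) (S g) = 0" by (simp add: orth_compl_def)
    moreover obtain b B where "0 < b" "0 < B" "\<And>u. u \<in> V \<Longrightarrow> b \<le> col_sq u \<and> col_sq u \<le> B"
      using col_sq_bounds by blast
    then have "(\<lambda>u. complex_of_real (col_sq u) * f u) \<in> ell2 V"
      by (intro ell2_mult_bounded[where B = B, THEN conjunct1] f2) (auto simp: col_sq_nonneg)
    ultimately have "f v * (complex_of_real (col_sq u) * f u) = f u * (complex_of_real (col_sq v) * f v)"
      using inner_shift_shift[OF f2 g] by (simp add: inner_g)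
    then show ?thesis using f(2) fv by simp
  qed simp
qed

section \<open>Balanced shifts\<close>

definition generation_multiplier :: "('v \<Rightarrow> real) \<Rightarrow> bool" where
  "generation_multiplier c \<longleftrightarrow>
    (\<exists>B. \<forall>v\<in>V. \<bar>c v\<bar> \<le> B) \<and> (\<forall>u\<in>V. \<forall>v\<in>V. same_generation E u v \<longrightarrow> c u = c v)"

text \<open>This is the property of a space \<open>X\<close> that lets \<open>S\<^sup>* S\<close> map \<open>X\<close> into itself in the balanced case.
  Asking for all generation multipliers, rather than for \<open>col_sq\<close> alone, makes the property pass from
  \<open>X\<close> to \<open>S X\<close>: pulling a multiplier back through \<open>S\<close> changes it.\<close>

definition multiplier_invariant :: "('v \<Rightarrow> complex) set \<Rightarrow> bool" where
  "multiplier_invariant X \<longleftrightarrow>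
    (\<forall>c f. generation_multiplier c \<longrightarrow> f \<in> X \<longrightarrow> (\<lambda>v. complex_of_real (c v) * f v) \<in> X)"

lemma multiplier_ell2:
  assumes "generation_multiplier c" "f \<in> ell2 V"
  shows "(\<lambda>v. complex_of_real (c v) * f v) \<in> ell2 V"
proof -
  obtain B where "\<forall>v\<in>V. \<bar>c v\<bar> \<le> B" using assms(1) by (auto simp: generation_multiplier_def)
  then show ?thesis
    by (intro ell2_mult_bounded[where B = "max B 0", THEN conjunct1] assms(2)) auto
qed

lemma multiplier_invariant_ell2: "multiplier_invariant (ell2 V)"
  by (simp add: multiplier_invariant_def multiplier_ell2)

text \<open>A generation multiplier takes one value on all children of \<open>u\<close>, so it can be moved through \<open>S\<close>
  after being read off at an arbitrary child; leaflessness provides that child.\<close>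

lemma multiplier_past_shift:
  assumes c: "generation_multiplier c"
  obtains c' where "generation_multiplier c'"
    "\<And>f. (\<lambda>v. complex_of_real (c v) * S f v) = S (\<lambda>v. complex_of_real (c' v) * f v)"
proof -
  define child where "child u = (SOME v. v \<in> V \<and> par E v = u)" for u
  have child: "child u \<in> V \<and> par E (child u) = u" if "u \<in> V" for u
    unfolding child_def by (rule someI_ex[of "\<lambda>v. v \<in> V \<and> par E v = u"])
      (use child_exists[OF that] in auto)
  obtain B where B: "\<forall>v\<in>V. \<bar>c v\<bar> \<le> B" using c by (auto simp: generation_multiplier_def)
  have const: "c u = c v" if "u \<in> V" "v \<in> V" "same_generation E (par E u) (par E v)" for u v
    using c that(1,2) same_generation_of_par[OF that(3)] by (simp add: generation_multiplier_def)
  have "generation_multiplier (\<lambda>u. c (child u))"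
    unfolding generation_multiplier_def
  proof (intro conjI ballI impI exI)
    show "\<bar>c (child v)\<bar> \<le> B" if "v \<in> V" for v using B child[OF that] by blast
    show "c (child u) = c (child v)" if "u \<in> V" "v \<in> V" "same_generation E u v" for u v
      using child[OF that(1)] child[OF that(2)] that(3) by (intro const) simp_all
  qed
  moreover have "(\<lambda>v. complex_of_real (c v) * S f v) = S (\<lambda>v. complex_of_real (c (child v)) * f v)" for f
  proof
    fix v
    have "c v = c (child (par E v))" if "v \<in> V"
      using that child[OF par_in[OF that]] by (intro const) (simp_all add: same_generation_def)
    then show "complex_of_real (c v) * S f v = S (\<lambda>v. complex_of_real (c (child v)) * f v) v"
      by (cases "v \<in> V") (simp_all add: shift_apply weighted_shift_def[of V E w _ v])
  qed
  ultimately show ?thesis by (rule that)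
qed

lemma multiplier_invariant_image:
  assumes X: "multiplier_invariant X"
  shows "multiplier_invariant (S ` X)"
  unfolding multiplier_invariant_def
proof (intro allI impI)
  fix c f assume c: "generation_multiplier c" and "f \<in> S ` X"
  then obtain g where g: "g \<in> X" "f = S g" by blast
  obtain c' where c': "generation_multiplier c'"
    "\<And>f. (\<lambda>v. complex_of_real (c v) * S f v) = S (\<lambda>v. complex_of_real (c' v) * f v)"
    using multiplier_past_shift[OF c] by blast
  have "(\<lambda>v. complex_of_real (c' v) * g v) \<in> X" using X c'(1) g(1) by (simp add: multiplier_invariant_def)
  then show "(\<lambda>v. complex_of_real (c v) * f v) \<in> S ` X" unfolding g(2) c'(2) by blast
qed

lemma multiplier_invariant_pow_image: "multiplier_invariant X \<Longrightarrow> multiplier_invariant ((S ^^ n) ` X)"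
proof (induction n)
  case (Suc n)
  then show ?case unfolding image_Suc by (intro multiplier_invariant_image)
qed simp

lemma multiplier_invariant_hyperrange: "multiplier_invariant M"
  using multiplier_invariant_pow_image[OF multiplier_invariant_ell2]
  unfolding multiplier_invariant_def hyperrange_def by blast

lemma ker_adj_shift: "K = orth_compl V (S ` ell2 V)"
  by (rule ker_adj[OF bounded])

lemma ker_ell2: "K \<subseteq> ell2 V"
  by (auto simp: ker_def)

lemma closed_subspace_ker: "closed_subspace V K"
  unfolding ker_adj_shift using shift_ell2 by (intro closed_subspace_orth_compl) blast

text \<open>The heart of the balanced case: \<open>\<langle>S x, S y\<rangle> = \<langle>d x, y\<rangle>\<close> where \<open>d = col_sq\<close> is a generation
  multiplier, so \<open>d x\<close> is still in \<open>X\<close>.\<close>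

lemma shift_preserves_orthogonality:
  assumes bal: "balanced V E w" and X: "multiplier_invariant X" "X \<subseteq> ell2 V"
    and Y: "Y \<subseteq> orth_compl V X"
  shows "S ` Y \<subseteq> orth_compl V (S ` X)"
proof -
  obtain b B where B: "0 < b" "0 < B" "\<And>u. u \<in> V \<Longrightarrow> b \<le> col_sq u \<and> col_sq u \<le> B"
    using col_sq_bounds by blast
  have "\<bar>col_sq v\<bar> \<le> B" if "v \<in> V" for v using B(3)[OF that] by (simp add: col_sq_nonneg)
  then have mult: "generation_multiplier col_sq"
    using bal unfolding generation_multiplier_def balanced_col_sq by blast
  have "ell2_inner V (S x) (S y) = 0" if x: "x \<in> X" and y: "y \<in> Y" for x y
  proof -
    have y2: "y \<in> ell2 V" and orth: "\<And>x. x \<in> X \<Longrightarrow> ell2_inner V x y = 0"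
      using Y y by (auto simp: orth_compl_def)
    have "(\<lambda>u. complex_of_real (col_sq u) * x u) \<in> X"
      using X(1) mult x unfolding multiplier_invariant_def by blast
    then show ?thesis using inner_shift_shift[of x y] x X(2) y2 orth by auto
  qed
  moreover have "S ` Y \<subseteq> ell2 V" using Y shift_ell2 by (auto simp: orth_compl_def)
  ultimately show ?thesis by (auto simp: orth_compl_def)
qed

lemma reduces_if_balanced:
  assumes "balanced V E w"
  shows "reduces V M S"
  unfolding reduces_def
  using shift_preserves_orthogonality[OF assms multiplier_invariant_hyperrange hyperrange_ell2 subset_refl]
    closed_subspace_hyperrange by (simp add: shift_hyperrange)

section \<open>The Wold decomposition\<close>

lemma wandering_orthogonal:
  assumes bal: "balanced V E w"
  shows "(S ^^ n) ` K \<subseteq> orth_compl V ((S ^^ Suc n) ` ell2 V)"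
proof (induction n)
  case 0
  then show ?case by (simp add: ker_adj_shift)
next
  case (Suc n)
  from shift_preserves_orthogonality[OF bal
      multiplier_invariant_pow_image[OF multiplier_invariant_ell2] pow_range_ell2 Suc.IH]
  show ?case unfolding image_Suc .
qed

text \<open>The operator \<open>(S\<^sup>* S)\<inverse> S\<^sup>*\<close>, the adjoint of the Cauchy dual of \<open>S\<close>. It is the left inverse of
  \<open>S\<close> that vanishes on \<open>ker S\<^sup>*\<close>, so \<open>S\<close> composed with it is the orthogonal projection onto the
  range of \<open>S\<close>.\<close>

definition cauchy_dual_adjoint :: "('v \<Rightarrow> complex) \<Rightarrow> 'v \<Rightarrow> complex" where
  "cauchy_dual_adjoint f v = complex_of_real (1 / col_sq v) * adj V S f v"

lemma cauchy_dual_adjoint: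
  assumes f: "f \<in> ell2 V"
  shows "cauchy_dual_adjoint f \<in> ell2 V" "(\<lambda>v. f v - S (cauchy_dual_adjoint f) v) \<in> K"
proof -
  obtain b B where b: "0 < b" "0 < B" "\<And>u. u \<in> V \<Longrightarrow> b \<le> col_sq u \<and> col_sq u \<le> B"
    using col_sq_bounds by blast
  note af = adjoint(1)[OF bounded f]
  have "cmod (complex_of_real (1 / col_sq v)) \<le> 1 / b" if "v \<in> V" for v
    using b(1) b(3)[OF that] by (simp add: norm_divide frac_le)
  then show h: "cauchy_dual_adjoint f \<in> ell2 V"
    unfolding cauchy_dual_adjoint_def[abs_def] using b(1)
    by (intro ell2_mult_bounded[where B = "1 / b", THEN conjunct1] af) auto
  let ?h = "cauchy_dual_adjoint f"
  have eq: "(\<lambda>u. complex_of_real (col_sq u) * ?h u) = adj V S f"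
  proof
    fix u show "complex_of_real (col_sq u) * ?h u = adj V S f u"
      using b(1) b(3)[of u] ell2_off[OF af, of u]
      by (cases "u \<in> V") (auto simp: cauchy_dual_adjoint_def)
  qed
  have "ell2_inner V (\<lambda>v. f v - S ?h v) (S x) = 0" if x: "x \<in> ell2 V" for x
  proof -
    have "ell2_inner V f (S x) = ell2_inner V (adj V S f) x"
      using adjoint(2)[OF bounded f x] ell2_inner_cnj[of V f "S x"] ell2_inner_cnj[of V "adj V S f" x]
      by simp
    also have "\<dots> = ell2_inner V (S ?h) (S x)" by (simp add: inner_shift_shift[OF h x] eq)
    finally show ?thesis by (simp add: ell2_inner_diff f shift_ell2 h x)
  qed
  then show "(\<lambda>v. f v - S ?h v) \<in> K"
    unfolding ker_adj_shift orth_compl_def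
    using ell2_diff[OF f shift_ell2[OF h]] ell2_inner_eq_0_sym by blast
qed

text \<open>With \<open>R = (S\<^sup>* S)\<inverse> S\<^sup>*\<close> the remainders are \<open>q\<^sub>n = S\<^sup>n R\<^sup>n f\<close>, and \<open>q\<^sub>n - q\<^sub>n\<^sub>+\<^sub>1\<close> is \<open>S\<^sup>n\<close>
  applied to the \<open>K\<close> component of \<open>R\<^sup>n f\<close>. Orthogonality turns distances between remainders into
  differences of squared norms, and these norms decrease.\<close>

lemma wold_expansion:
  assumes bal: "balanced V E w" and f: "f \<in> ell2 V"
  shows "\<exists>r\<in>M. \<exists>k. (\<forall>n. k n \<in> (S ^^ n) ` K) \<and> ell2_converges V (\<lambda>n v. r v + (\<Sum>j<n. k j v)) f"
proof -
  let ?R = cauchy_dual_adjoint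
  define q where "q n = (S ^^ n) ((?R ^^ n) f)" for n
  define k where "k n v = q n v - q (Suc n) v" for n v
  have R: "(?R ^^ n) f \<in> ell2 V" for n
    by (induction n) (simp_all add: f cauchy_dual_adjoint(1))
  have q: "q n \<in> ell2 V" for n unfolding q_def by (rule pow_ell2[OF R])
  have q_range: "q n \<in> (S ^^ m) ` ell2 V" if "m \<le> n" for m n
    using pow_range_antimono[OF that] R unfolding q_def by blast
  have pow_diff: "(S ^^ n) (\<lambda>v. a v - b v) = (\<lambda>v. (S ^^ n) a v - (S ^^ n) b v)"
    if "a \<in> ell2 V" "b \<in> ell2 V" for a b n
    by (induction n) (simp_all add: bounded_operator_diff[OF bounded] pow_ell2 that)
  have k: "k n \<in> (S ^^ n) ` K" for n
  proof -
    let ?a = "(?R ^^ n) f"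
    have "k n = (\<lambda>v. (S ^^ n) ?a v - (S ^^ n) (S (?R ?a)) v)"
      by (simp add: k_def[abs_def] q_def funpow_swap1)
    also have "\<dots> = (S ^^ n) (\<lambda>v. ?a v - S (?R ?a) v)"
      by (rule pow_diff[symmetric, OF R shift_ell2[OF cauchy_dual_adjoint(1)[OF R]]])
    finally show ?thesis using cauchy_dual_adjoint(2)[OF R[of n]] by blast
  qed
  have k2: "k n \<in> ell2 V" for n by (rule subsetD[OF order_trans[OF image_mono[OF ker_ell2] pow_range_ell2] k])
  have orth: "ell2_inner V (\<lambda>v. q n v - q (n + j) v) x = 0"
    if "x \<in> (S ^^ (n + j)) ` ell2 V" for n j x
    using that
  proof (induction j)
    case (Suc j)
    have x: "x \<in> ell2 V" by (rule subsetD[OF pow_range_ell2 Suc.prems])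
    have "x \<in> (S ^^ (n + j)) ` ell2 V"
      using Suc.prems pow_range_antimono[of "n + j" "n + Suc j"] by auto
    then have "ell2_inner V (\<lambda>v. q n v - q (n + j) v) x = 0" by (rule Suc.IH)
    moreover have "ell2_inner V (k (n + j)) x = 0"
      using wandering_orthogonal[OF bal, of "n + j"] k[of "n + j"] Suc.prems
      ell2_inner_eq_0_sym[of V x] by (auto simp: orth_compl_def simp del: funpow.simps)
    ultimately have "ell2_inner V (\<lambda>v. (q n v - q (n + j) v) + k (n + j) v) x = 0"
      using ell2_inner_add[OF ell2_diff[OF q q] k2 x] by simp
    then show ?case by (simp add: k_def)
  qed simp
  \<comment> \<open>Pythagoras: a difference of two remainders is orthogonal to the later of the two.\<close>
  have norm_q: "(ell2_norm V (q n))\<^sup>2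
      = (ell2_norm V (\<lambda>v. q n v - q (n + j) v))\<^sup>2 + (ell2_norm V (q (n + j)))\<^sup>2" for n j
    using ell2_Pythagoras[OF ell2_diff[OF q[of n] q[of "n + j"]] q[of "n + j"] orth[OF q_range]] by simp
  have conv: "convergent (\<lambda>n. (ell2_norm V (q n))\<^sup>2)"
  proof (rule Bseq_monoseq_convergent)
    have dec: "decseq (\<lambda>n. (ell2_norm V (q n))\<^sup>2)"
    proof (rule decseq_SucI)
      show "(ell2_norm V (q (Suc n)))\<^sup>2 \<le> (ell2_norm V (q n))\<^sup>2" for n
        unfolding norm_q[of n 1] by simp
    qed
    then show "monoseq (\<lambda>n. (ell2_norm V (q n))\<^sup>2)" by (rule decseq_imp_monoseq)
    show "Bseq (\<lambda>n. (ell2_norm V (q n))\<^sup>2)"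
      by (rule decseq_bounded[OF dec, of 0]) simp
  qed
  have "\<exists>N. \<forall>m\<ge>N. \<forall>n\<ge>N. ell2_norm V (\<lambda>v. q m v - q n v) \<le> e" if "e > 0" for e :: real
  proof -
    have "Cauchy (\<lambda>n. (ell2_norm V (q n))\<^sup>2)" using conv Cauchy_convergent_iff by blast
    then obtain N where N: "\<And>m n. m \<ge> N \<Longrightarrow> n \<ge> N \<Longrightarrow>
        \<bar>(ell2_norm V (q m))\<^sup>2 - (ell2_norm V (q n))\<^sup>2\<bar> < e\<^sup>2"
      using CauchyD[of _ "e\<^sup>2"] \<open>e > 0\<close> by (metis real_norm_def zero_less_power)
    have ord: "ell2_norm V (\<lambda>v. q m v - q n v) \<le> e" if "m \<ge> N" "m \<le> n" for m n
    proof -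
      have "(ell2_norm V (\<lambda>v. q m v - q n v))\<^sup>2
          = (ell2_norm V (q m))\<^sup>2 - (ell2_norm V (q n))\<^sup>2"
        using norm_q[of m "n - m"] unfolding le_add_diff_inverse[OF that(2)] by linarith
      then have "(ell2_norm V (\<lambda>v. q m v - q n v))\<^sup>2 \<le> e\<^sup>2"
        using N[of m n] that by linarith
      then show ?thesis by (rule power2_le_imp_le) (use \<open>e > 0\<close> in simp)
    qed
    have "ell2_norm V (\<lambda>v. q m v - q n v) \<le> e" if "m \<ge> N" "n \<ge> N" for m n
      using ord[of m n] ord[of n m] that ell2_norm_diff_commute[of V "q m" "q n"] by (cases "m \<le> n") auto
    then show ?thesis by blast
  qed
  from ell2_complete[OF q this] obtain r where r: "r \<in> ell2 V" "ell2_converges V q r" by blast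
  have "r \<in> (S ^^ m) ` ell2 V" for m
  proof (rule closed_subspaceD(5)[OF closed_subspace_pow_image[OF closed_subspace_ell2] _ r(1)])
    show "q (j + m) \<in> (S ^^ m) ` ell2 V" for j by (rule q_range) simp
    show "ell2_converges V (\<lambda>j. q (j + m)) r"
      using r(2) unfolding ell2_converges_def by (rule LIMSEQ_ignore_initial_segment)
  qed
  then have "r \<in> M" by (simp add: hyperrange_def)
  moreover have "ell2_converges V (\<lambda>n v. r v + (\<Sum>j<n. k j v)) f"
  proof -
    have "(\<Sum>j<n. k j v) = f v - q n v" for n v
      unfolding k_def by (induction n) (simp_all add: q_def del: funpow.simps(2))
    then have "(\<lambda>v. r v + (\<Sum>j<n. k j v) - f v) = (\<lambda>v. r v - q n v)" for n by simp
    then show ?thesis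
      using r(2) unfolding ell2_converges_def by (simp only: ell2_norm_diff_commute[of V r])
  qed
  ultimately show ?thesis using k by blast
qed

text \<open>Each component other than the hyperrange is orthogonal to the range of the next power of \<open>S\<close>, which
  contains the hyperrange and all later components. The hyperrange sits at index 0, so it counts as
  later than every other component.\<close>

lemma wold_decomposition:
  assumes bal: "balanced V E w"
  shows "hilbert_direct_sum V (case_nat M (\<lambda>n. (S ^^ n) ` K))"
proof -
  let ?X = "case_nat M (\<lambda>n. (S ^^ n) ` K)"
  have range: "?X n \<subseteq> (S ^^ m) ` ell2 V" if "n = 0 \<or> m < n" for m n
  proof (cases n)
    case 0
    then show ?thesis by (auto simp: hyperrange_def)
  next
    case (Suc l)
    have "(S ^^ l) ` K \<subseteq> (S ^^ l) ` ell2 V" using ker_ell2 by blast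
    then show ?thesis using Suc that pow_range_antimono[of m l] by auto
  qed
  have orth: "ell2_inner V f g = 0" if "f \<in> ?X n" "g \<in> ?X (Suc m)" "n = 0 \<or> Suc m < n" for f g m n
  proof -
    have "g \<in> (S ^^ m) ` K" using that(2) by (simp only: nat.case)
    then have "g \<in> orth_compl V ((S ^^ Suc m) ` ell2 V)" by (rule subsetD[OF wandering_orthogonal[OF bal]])
    moreover have "f \<in> (S ^^ Suc m) ` ell2 V" by (rule subsetD[OF range[OF that(3)] that(1)])
    ultimately show ?thesis unfolding orth_compl_def by blast
  qed
  have "ell2_inner V f g = 0" if fg: "f \<in> ?X m" "g \<in> ?X n" and "m \<noteq> n" for f g m n
  proof (cases "n = 0 \<or> 0 < m \<and> m < n")
    case True
    then obtain l where "m = Suc l" using \<open>m \<noteq> n\<close> by (cases m) auto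
    then show ?thesis using orth[of g n f l] fg True ell2_inner_eq_0_sym by blast
  next
    case False
    then obtain l where "n = Suc l" by (cases n) auto
    then show ?thesis using orth[of f m g l] fg False \<open>m \<noteq> n\<close> by auto
  qed
  moreover have "closed_subspace V (?X n)" for n
    using closed_subspace_hyperrange closed_subspace_pow_image[OF closed_subspace_ker]
    by (cases n) auto
  moreover have "\<exists>g. (\<forall>n. g n \<in> ?X n) \<and> ell2_converges V (\<lambda>n v. \<Sum>k<n. g k v) f"
    if f: "f \<in> ell2 V" for f
  proof -
    obtain r k where r: "r \<in> M" and k: "\<forall>n. k n \<in> (S ^^ n) ` K"
      and conv: "ell2_converges V (\<lambda>n v. r v + (\<Sum>j<n. k j v)) f"
      using wold_expansion[OF bal f] by blast
    let ?g = "case_nat r k"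
    \<comment> \<open>The hyperrange component occupies index 0, which shifts the partial sums by one.\<close>
    have "(\<lambda>n. ell2_norm V (\<lambda>v. (\<Sum>j<Suc n. ?g j v) - f v)) \<longlonglongrightarrow> 0"
      using conv unfolding ell2_converges_def sum.lessThan_Suc_shift by simp
    then have "ell2_converges V (\<lambda>n v. \<Sum>j<n. ?g j v) f"
      unfolding ell2_converges_def by (subst (asm) filterlim_sequentially_Suc)
    moreover have "\<forall>n. ?g n \<in> ?X n" using r k by (auto split: nat.split)
    ultimately show ?thesis by blast
  qed
  ultimately show ?thesis unfolding hilbert_direct_sum_def by blast
qed

end

theorem theorem4p1:
  fixes V :: "'v set" and E :: "('v \<times> 'v) set" and w :: "'v \<Rightarrow> real"
  defines "S \<equiv> weighted_shift V E w"
  assumes "directed_tree V E"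
    and "countable V" and "infinite V"
    and "leafless V E" and "rootless V E"
    and "\<And>v. v \<in> V \<Longrightarrow> w v > 0"
    and "bounded_operator V S"
    and "left_invertible V S"
    and "\<not> analytic_operator V S"
  shows "(reduces V (hyperrange V S) S \<longleftrightarrow> balanced V E w) \<and>
         (balanced V E w \<longrightarrow>
            hilbert_direct_sum V
              (case_nat (hyperrange V S) (\<lambda>n. (S ^^ n) ` ker V (adj V S))))"
proof -
  interpret tree_shift V E w
    using assms by unfold_locales (auto simp: S_def)
  show ?thesis
    using balanced_if_reduces reduces_if_balanced wold_decomposition assms(10)
    unfolding S_def by blast
qed

end
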